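(* Let $m=m(n)$ and $k=k(n)$ be positive integer sequences with $n\ll m\ll n^2/\log^2 n$ and $k\sim\alpha\sqrt{m/n}$ for some fixed $\alpha>0$. Fix $\rho\in[0,1]$. For each $n$, let $\boldsymbol{\sigma}_{n,m}$ be a permutation chosen uniformly at random from the set of permutations of $[n]$ with exactly $m$ inversions. Then, for any sequence of permutations $(\tau_n)$ with $|\tau_n|=k$ and $\mathrm{dinv}(\tau_n)\sim\rho$, and any sequence of positive integers $(j_n)$ with $j_n\leq n+1-k$, \[\mathbb{P}\big(\text{$\tau_n$ occurs at position $j_n$ in $\boldsymbol{\sigma}_{n,m}$}\big)\sim e^{(1-2\rho)\alpha^2/4}\,\frac{1}{k!}.\]
   Context: A permutation $\sigma$ of length $n$ is a linear ordering $\sigma(1)\ldots\sigma(n)$ of $[n]$; $|\sigma|$ denotes its length. An inversion of $\sigma$ is a pair $i<j$ with $\sigma(i)>\sigma(j)$; $\mathrm{inv}(\sigma)$ is the number of inversions and the inversion density is $\mathrm{dinv}(\sigma)=\mathrm{inv}(\sigma)/\binom{|\sigma|}{2}$. For sequences, $f\ll g$ means $f/g\to0$ and $f\sim g$ means $f/g\to1$ as $n\to\infty$. A pattern $\tau$ of length $k$ occurs at position $j$ in $\sigma$ if $\sigma(j)\ldots\sigma(j+k-1)$ has its entries in the same relative order as $\tau(1)\ldots\tau(k)$. *)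

theory Defs
  imports
    "HOL-Combinatorics.Permutations"
    "HOL-Library.Landau_Symbols"
    "HOL-Probability.Probability_Mass_Function"
begin

text \<open>
  A permutation of length \<open>n\<close> is a function \<open>\<sigma>\<close> with \<open>\<sigma> permutes {1..n}\<close>. As such a
  function does not determine \<open>n\<close> (it is the identity outside \<open>{1..n}\<close>), the length is passed
  explicitly.
\<close>

definition inversions :: "nat \<Rightarrow> (nat \<Rightarrow> nat) \<Rightarrow> (nat \<times> nat) set" where
  "inversions n \<sigma> = {(i, j). i \<in> {1..n} \<and> j \<in> {1..n} \<and> i < j \<and> \<sigma> i > \<sigma> j}"

definition inv_count :: "nat \<Rightarrow> (nat \<Rightarrow> nat) \<Rightarrow> nat" where
  "inv_count n \<sigma> = card (inversions n \<sigma>)"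

definition dinv :: "nat \<Rightarrow> (nat \<Rightarrow> nat) \<Rightarrow> real" where
  "dinv n \<sigma> = real (inv_count n \<sigma>) / real (n choose 2)"

definition perms_with_inv :: "nat \<Rightarrow> nat \<Rightarrow> (nat \<Rightarrow> nat) set" where
  "perms_with_inv n m = {\<sigma>. \<sigma> permutes {1..n} \<and> inv_count n \<sigma> = m}"

text \<open>
  The law of the uniform random permutation. It is unspecified when no permutation of length
  \<open>n\<close> has \<open>m\<close> inversions, that is, for \<open>m > n choose 2\<close>.
\<close>

definition random_perm :: "nat \<Rightarrow> nat \<Rightarrow> (nat \<Rightarrow> nat) pmf" where
  "random_perm n m = pmf_of_set (perms_with_inv n m)"

text \<open>
  Positions count from 1, so the window consists of \<open>\<sigma> j, \<dots>, \<sigma> (j + k - 1)\<close>; it lies inside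
  \<open>{1..n}\<close> only if \<open>1 \<le> j\<close> and \<open>j + k \<le> n + 1\<close>.
\<close>

definition occurs_at :: "nat \<Rightarrow> (nat \<Rightarrow> nat) \<Rightarrow> nat \<Rightarrow> (nat \<Rightarrow> nat) \<Rightarrow> bool" where
  "occurs_at k \<tau> j \<sigma> \<longleftrightarrow>
     (\<forall>a\<in>{1..k}. \<forall>b\<in>{1..k}. \<sigma> (j + a - 1) < \<sigma> (j + b - 1) \<longleftrightarrow> \<tau> a < \<tau> b)"

end

theory Submission
  imports
    Defs
    "HOL-Computational_Algebra.Polynomial"
    "HOL-Real_Asymp.Real_Asymp"
begin

text \<open>
  Sorting the window of a permutation splits it into a permutation increasing on the window and the
  pattern in the window, and inversion numbers add up. Hence, if \<open>a\<^sub>s\<close> are the coefficients of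
  \<open>A(x) = [k+1]\<^sub>x \<cdots> [n]\<^sub>x\<close>, the probability that \<open>\<tau>\<close> occurs is \<open>a\<^bsub>m - inv \<tau>\<^esub>\<close> divided by the
  sum of \<open>a\<^bsub>m - inv \<pi>\<^esub>\<close> over all patterns \<open>\<pi>\<close> of length \<open>k\<close>; the position plays no role.
  The sequence \<open>a\<close> is log-concave, so its ratios \<open>a\<^bsub>s-1\<^esub> / a\<^sub>s\<close> increase. If the ratio at \<open>m\<close> were on
  the wrong side of \<open>q = 1 - w n/m\<close>, where \<open>w \<noteq> 1\<close>, then with \<open>y = 1 - n/m\<close> one would have
  \<open>A(q) y\<^sup>m \<le> (deg A + 1) A(y) q\<^sup>m\<close>; but the logarithms of the two sides, divided by \<open>n\<close>, differ in the
  limit by \<open>- ln w - (1 - w) > 0\<close>. Hence \<open>a\<^bsub>m-s\<^esub> / a\<^sub>m\<close> is close to \<open>exp (- s n/m)\<close> for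
  \<open>s \<le> k(k-1)/2\<close>. The numerator then contributes \<open>exp (- \<rho> \<alpha>\<^sup>2/2)\<close>, and the denominator is governed by
  the inversion generating function \<open>[1]\<^sub>q \<cdots> [k]\<^sub>q\<close> near \<open>q = 1 - n/m\<close>, which is about
  \<open>k! exp (- \<alpha>\<^sup>2/4)\<close>.
\<close>

section \<open>Window decomposition of permutations\<close>

text \<open>It acts on positions: composing with it on the right rearranges the entries inside the
  window according to \<open>\<pi>\<close> and leaves the other entries alone.\<close>

definition window_perm :: "nat \<Rightarrow> nat \<Rightarrow> (nat \<Rightarrow> nat) \<Rightarrow> nat \<Rightarrow> nat" where
  "window_perm j k \<pi> i = (if i \<in> {j..<j + k} then j + \<pi> (i + 1 - j) - 1 else i)"

text \<open>For a window inside \<open>{1..n}\<close> these are the minimal-length representatives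
  of the left cosets of the group of window permutations.\<close>

definition window_increasing :: "nat \<Rightarrow> nat \<Rightarrow> nat \<Rightarrow> (nat \<Rightarrow> nat) set" where
  "window_increasing n j k = {\<sigma>. \<sigma> permutes {1..n} \<and> strict_mono_on {j..<j + k} \<sigma>}"

lemma finite_window_increasing: "finite (window_increasing n j k)"
  by (rule finite_subset[OF _ finite_permutations[of "{1..n}"]]) (auto simp: window_increasing_def)

lemma window_perm_nth:
  assumes "1 \<le> j" "a \<in> {1..k}"
  shows "window_perm j k \<pi> (j + a - 1) = j + \<pi> a - 1"
  using assms by (auto simp: window_perm_def)

lemma window_nthE:
  fixes j k i :: nat
  assumes "i \<in> {j..<j + k}" "1 \<le> j"
  obtains a where "a \<in> {1..k}" "i = j + a - 1"
  using assms by (intro that[of "i + 1 - j"]) auto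

lemma window_perm_permutes:
  assumes \<pi>: "\<pi> permutes {1..k}" and j: "1 \<le> j"
  shows "window_perm j k \<pi> permutes {j..<j + k}"
proof (rule bij_imp_permutes)
  let ?p = "window_perm j k \<pi>" and ?W = "{j..<j + k}"
  have sub: "?p ` ?W \<subseteq> ?W"
  proof
    fix y assume "y \<in> ?p ` ?W"
    then obtain x where x: "x \<in> ?W" "y = ?p x" by blast
    obtain a where a: "a \<in> {1..k}" "x = j + a - 1" using window_nthE[OF x(1) j] .
    have "\<pi> a \<in> {1..k}" using a(1) permutes_in_image[OF \<pi>] by blast
    then show "y \<in> ?W" using x a window_perm_nth[OF j a(1)] j by auto
  qed
  have inj: "inj_on ?p ?W"
  proof (rule inj_onI)
    fix x y assume xy: "x \<in> ?W" "y \<in> ?W" "?p x = ?p y"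
    obtain a where a: "a \<in> {1..k}" "x = j + a - 1" using window_nthE[OF xy(1) j] .
    obtain b where b: "b \<in> {1..k}" "y = j + b - 1" using window_nthE[OF xy(2) j] .
    have "\<pi> a \<in> {1..k}" "\<pi> b \<in> {1..k}" using a(1) b(1) permutes_in_image[OF \<pi>] by blast+
    then have "\<pi> a = \<pi> b"
      using xy(3) a b window_perm_nth[OF j a(1), of \<pi>] window_perm_nth[OF j b(1), of \<pi>] j by auto
    then have "a = b" using permutes_inj[OF \<pi>] by (simp add: inj_eq)
    then show "x = y" using a b by simp
  qed
  show "bij_betw ?p ?W ?W"
    using inj endo_inj_surj[OF _ sub inj] by (simp add: bij_betw_def)
qed (auto simp: window_perm_def)

text \<open>The window is an interval of positions mapped to itself, so how an outside position
  compares with a window position does not depend on which window position it is.\<close>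

lemma window_perm_less_iff:
  assumes p: "window_perm j k \<pi> permutes {j..<j + k}"
    and xy: "\<not> (x \<in> {j..<j + k} \<and> y \<in> {j..<j + k})"
  shows "window_perm j k \<pi> x < window_perm j k \<pi> y \<longleftrightarrow> x < y"
proof -
  have out: "window_perm j k \<pi> z = z" if "z \<notin> {j..<j + k}" for z
    using that by (simp only: window_perm_def if_False)
  have inn: "window_perm j k \<pi> z \<in> {j..<j + k}" if "z \<in> {j..<j + k}" for z
    using that permutes_in_image[OF p] by blast
  consider "x \<in> {j..<j + k}" "y \<notin> {j..<j + k}" | "x \<notin> {j..<j + k}" "y \<in> {j..<j + k}"
    | "x \<notin> {j..<j + k}" "y \<notin> {j..<j + k}" using xy by blast
  then show ?thesis
  proof cases
    case 1 then show ?thesis using out[of y] inn[of x] by auto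
  next
    case 2 then show ?thesis using out[of x] inn[of y] by auto
  next
    case 3 then show ?thesis using out[of x] out[of y] by auto
  qed
qed

text \<open>Split the inversions by whether both positions lie in the window. The others correspond
  to the inversions of \<open>\<sigma>\<close> under the window permutation; inside the window
  \<open>\<sigma>\<close> is increasing, so only the comparisons made by \<open>\<pi>\<close>
  count.\<close>

lemma inv_count_comp_window_perm:
  assumes \<sigma>: "\<sigma> \<in> window_increasing n j k" and \<pi>: "\<pi> permutes {1..k}"
    and j: "1 \<le> j" "j + k \<le> n + 1"
  shows "inv_count n (\<sigma> \<circ> window_perm j k \<pi>) = inv_count n \<sigma> + inv_count k \<pi>"
proof -
  let ?p = "window_perm j k \<pi>" and ?W = "{j..<j + k}"
  have \<sigma>p: "\<sigma> permutes {1..n}" and mono: "strict_mono_on ?W \<sigma>"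
    using \<sigma> by (auto simp: window_increasing_def)
  have p: "?p permutes ?W" by (rule window_perm_permutes[OF \<pi> j(1)])
  have pn: "?p permutes {1..n}" by (rule permutes_subset[OF p]) (use j in auto)
  have inW: "?p x \<in> ?W \<longleftrightarrow> x \<in> ?W" for x by (rule permutes_in_image[OF p])
  have inN: "?p x \<in> {1..n} \<longleftrightarrow> x \<in> {1..n}" for x by (rule permutes_in_image[OF pn])
  have \<sigma>less: "\<sigma> x < \<sigma> y \<longleftrightarrow> x < y" if "x \<in> ?W" "y \<in> ?W" for x y
    using mono that by (rule strict_mono_on_less)
  define I where "I = inversions n (\<sigma> \<circ> ?p)"
  have finI: "finite I"
    by (rule finite_subset[of _ "{1..n} \<times> {1..n}"]) (auto simp: I_def inversions_def)
  let ?WW = "?W \<times> ?W"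
  have "card (I - ?WW) = card (inversions n \<sigma>)"
  proof (rule bij_betw_same_card[of "map_prod ?p ?p"], rule bij_betw_imageI)
    show "inj_on (map_prod ?p ?p) (I - ?WW)"
      by (rule inj_on_subset[OF _ subset_UNIV], rule prod.inj_map) (rule permutes_inj[OF p])+
    show "map_prod ?p ?p ` (I - ?WW) = inversions n \<sigma>"
    proof (intro equalityI subsetI)
      fix z assume "z \<in> map_prod ?p ?p ` (I - ?WW)"
      then obtain w where w: "z = map_prod ?p ?p w" "w \<in> I - ?WW" by (rule imageE)
      obtain x y where "w = (x, y)" by (cases w)
      with w have xy: "(x, y) \<in> I" "(x, y) \<notin> ?WW" "z = (?p x, ?p y)" by simp_all
      have "?p x < ?p y"
        using xy window_perm_less_iff[OF p, of x y] by (auto simp: I_def inversions_def)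
      then show "z \<in> inversions n \<sigma>"
        using xy inN[of x] inN[of y] by (auto simp: I_def inversions_def)
    next
      fix z assume z: "z \<in> inversions n \<sigma>"
      then obtain u v where uv: "z = (u, v)" "u < v" "\<sigma> u > \<sigma> v" "u \<in> {1..n}" "v \<in> {1..n}"
        by (auto simp: inversions_def)
      obtain x y where x: "u = ?p x" and y: "v = ?p y" using permutes_surj[OF p] by (metis surjD)
      \<comment> \<open>An inversion of \<open>\<sigma>\<close> cannot have both positions in the
        window, where \<open>\<sigma>\<close> increases; hence every inversion of
        \<open>\<sigma>\<close> is reached.\<close>
      have nW: "\<not> (x \<in> ?W \<and> y \<in> ?W)" using uv \<sigma>less[of u v] inW x y by auto
      have "x < y" using uv(2) window_perm_less_iff[OF p nW] x y by simp
      moreover have "x \<in> {1..n}" "y \<in> {1..n}" using uv(4,5) inN[of x] inN[of y] unfolding x y by blast+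
      ultimately have "(x, y) \<in> I - ?WW" using uv(3) nW unfolding x y by (simp add: I_def inversions_def)
      then show "z \<in> map_prod ?p ?p ` (I - ?WW)" using uv(1) unfolding x y by (intro image_eqI[of _ _ "(x, y)"]) simp_all
    qed
  qed
  moreover have "card (I \<inter> ?WW) = card (inversions k \<pi>)"
  proof (rule sym, rule bij_betw_same_card[of "map_prod (\<lambda>a. j + a - 1) (\<lambda>a. j + a - 1)"],
      rule bij_betw_imageI)
    let ?f = "\<lambda>a. j + a - 1"
    show "inj_on (map_prod ?f ?f) (inversions k \<pi>)"
      using j(1) by (auto simp: inj_on_def)
    have key: "?p (?f a) = ?f (\<pi> a) \<and> ?f a \<in> ?W \<and> ?f (\<pi> a) \<in> ?W \<and> ?f a \<in> {1..n}" if "a \<in> {1..k}" for a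
      using window_perm_nth[OF j(1) that, of \<pi>] permutes_in_image[OF \<pi>, of a] that j by auto
    have lt: "\<sigma> (?p (?f a)) > \<sigma> (?p (?f b)) \<longleftrightarrow> \<pi> a > \<pi> b" if "a \<in> {1..k}" "b \<in> {1..k}" for a b
    proof -
      have "\<sigma> (?f (\<pi> b)) < \<sigma> (?f (\<pi> a)) \<longleftrightarrow> ?f (\<pi> b) < ?f (\<pi> a)"
        using key[OF that(1)] key[OF that(2)] by (intro \<sigma>less) blast+
      also have "\<dots> \<longleftrightarrow> \<pi> b < \<pi> a" using j(1) by linarith
      finally show ?thesis using key[OF that(1)] key[OF that(2)] by simp
    qed
    show "map_prod ?f ?f ` inversions k \<pi> = I \<inter> ?WW"
    proof (intro equalityI subsetI)
      fix z assume "z \<in> map_prod ?f ?f ` inversions k \<pi>"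
      then obtain a b where ab: "z = (?f a, ?f b)" "a \<in> {1..k}" "b \<in> {1..k}" "a < b" "\<pi> a > \<pi> b"
        by (auto simp: inversions_def)
      have "?f a < ?f b" using ab j by auto
      then show "z \<in> I \<inter> ?WW"
        using ab key[OF ab(2)] key[OF ab(3)] lt[OF ab(2,3)]
        unfolding I_def inversions_def by (simp only: mem_Collect_eq case_prod_conv Int_iff mem_Sigma_iff o_def)
    next
      fix z assume "z \<in> I \<inter> ?WW"
      then obtain x y where xy: "z = (x, y)" "x \<in> ?W" "y \<in> ?W" "x < y" "\<sigma> (?p x) > \<sigma> (?p y)"
        by (auto simp: I_def inversions_def)
      obtain a where a: "a \<in> {1..k}" "x = ?f a" using window_nthE[OF xy(2) j(1)] .
      obtain b where b: "b \<in> {1..k}" "y = ?f b" using window_nthE[OF xy(3) j(1)] .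
      have "(a, b) \<in> inversions k \<pi>"
        using lt[OF a(1) b(1)] xy a b by (auto simp: inversions_def)
      then show "z \<in> map_prod ?f ?f ` inversions k \<pi>" using xy a b by (auto intro!: image_eqI[of _ _ "(a,b)"])
    qed
  qed
  moreover have "card I = card (I - ?WW) + card (I \<inter> ?WW)"
    using finI by (metis card_Diff_subset_Int card_mono Int_lower1 finite_Int le_add_diff_inverse2)
  ultimately show ?thesis by (simp add: inv_count_def I_def)
qed

section \<open>The pattern formed by the entries of a window\<close>

lemma permutes_eq_card_le:
  assumes "\<pi> permutes {1..k}" "a \<in> {1..k}"
  shows "\<pi> a = card {b \<in> {1..k}. \<pi> b \<le> \<pi> a}"
proof -
  have "\<pi> ` {b \<in> {1..k}. \<pi> b \<le> \<pi> a} = {1..\<pi> a}"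
  proof (intro equalityI subsetI)
    fix v assume v: "v \<in> {1..\<pi> a}"
    have "\<pi> a \<le> k" using permutes_in_image[OF assms(1), of a] assms(2) by simp
    then have "v \<in> \<pi> ` {1..k}" using v permutes_image[OF assms(1)] by auto
    then show "v \<in> \<pi> ` {b \<in> {1..k}. \<pi> b \<le> \<pi> a}" using v by auto
  next
    fix v assume "v \<in> \<pi> ` {b \<in> {1..k}. \<pi> b \<le> \<pi> a}"
    then obtain b where "b \<in> {1..k}" "\<pi> b \<le> \<pi> a" "v = \<pi> b" by blast
    then show "v \<in> {1..\<pi> a}" using permutes_in_image[OF assms(1), of b] by auto
  qed
  then have "\<pi> a = card (\<pi> ` {b \<in> {1..k}. \<pi> b \<le> \<pi> a})" by simp
  also have "\<dots> = card {b \<in> {1..k}. \<pi> b \<le> \<pi> a}"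
    by (intro card_image inj_on_subset[OF permutes_inj[OF assms(1)]]) auto
  finally show ?thesis .
qed

text \<open>Both patterns make the same comparisons as the window, and a value of a permutation is
  its rank, which comparisons determine.\<close>

lemma pattern_unique:
  assumes \<pi>: "\<pi> permutes {1..k}" and \<pi>': "\<pi>' permutes {1..k}"
    and "occurs_at k \<pi> j \<sigma>" "occurs_at k \<pi>' j \<sigma>"
  shows "\<pi> = \<pi>'"
proof
  fix a
  have iff: "\<pi> x \<le> \<pi> y \<longleftrightarrow> \<pi>' x \<le> \<pi>' y" if "x \<in> {1..k}" "y \<in> {1..k}" for x y
    using assms(3,4) that unfolding occurs_at_def by (metis linorder_not_less)
  show "\<pi> a = \<pi>' a"
  proof (cases "a \<in> {1..k}")
    case True
    have "{b \<in> {1..k}. \<pi> b \<le> \<pi> a} = {b \<in> {1..k}. \<pi>' b \<le> \<pi>' a}" using iff True by blast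
    then show ?thesis using permutes_eq_card_le[OF \<pi> True] permutes_eq_card_le[OF \<pi>' True] by simp
  next
    case False
    then show ?thesis using \<pi> \<pi>' by (simp add: permutes_not_in)
  qed
qed

text \<open>Standardization: each window entry is replaced by its rank among the window entries.
  Injectivity of \<open>\<sigma>\<close> excludes ties.\<close>

lemma pattern_exists:
  assumes \<sigma>: "inj \<sigma>" and j: "1 \<le> j"
  obtains \<pi> where "\<pi> permutes {1..k}" "occurs_at k \<pi> j \<sigma>"
proof -
  define s where "s a = \<sigma> (j + a - 1)" for a
  have s_inj: "s x = s y \<Longrightarrow> x = y" for x y
    using injD[OF \<sigma>, of "j + x - 1" "j + y - 1"] j by (auto simp: s_def)
  define D where "D a = {b \<in> {1..k}. s b \<le> s a}" for a
  define \<pi> where "\<pi> a = (if a \<in> {1..k} then card (D a) else a)" for a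
  have less: "\<pi> a < \<pi> b" if "a \<in> {1..k}" "b \<in> {1..k}" "s a < s b" for a b
  proof -
    have "D a \<subseteq> D b" "b \<in> D b" "b \<notin> D a" using that by (auto simp: D_def)
    then have "D a \<subset> D b" by blast
    then have "card (D a) < card (D b)" by (intro psubset_card_mono) (auto simp: D_def)
    then show ?thesis using that by (simp only: \<pi>_def if_True)
  qed
  have iff: "s a < s b \<longleftrightarrow> \<pi> a < \<pi> b" if "a \<in> {1..k}" "b \<in> {1..k}" for a b
    using less[OF that] less[OF that(2,1)] s_inj[of a b] by (metis linorder_neqE_nat not_less_iff_gr_or_eq)
  have sub: "\<pi> ` {1..k} \<subseteq> {1..k}"
  proof
    fix y assume "y \<in> \<pi> ` {1..k}"
    then obtain a where a: "a \<in> {1..k}" "y = \<pi> a" by blast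
    have "a \<in> D a" using a by (simp add: D_def)
    then have "card (D a) > 0" by (metis D_def card_gt_0_iff empty_iff finite_Collect_conjI finite_atLeastAtMost Collect_mem_eq)
    moreover have "card (D a) \<le> card {1..k}" by (intro card_mono) (auto simp: D_def)
    ultimately show "y \<in> {1..k}" using a by (simp add: \<pi>_def)
  qed
  have inj: "inj_on \<pi> {1..k}"
    using iff s_inj by (intro inj_onI) (metis linorder_neqE_nat less_irrefl)
  have "\<pi> permutes {1..k}"
    by (rule bij_imp_permutes) (use inj endo_inj_surj[OF _ sub inj] in \<open>auto simp: bij_betw_def \<pi>_def\<close>)
  moreover have "occurs_at k \<pi> j \<sigma>"
    using iff by (simp add: occurs_at_def s_def)
  ultimately show ?thesis using that by blast
qed

lemma occurs_at_comp_window_perm: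
  assumes \<sigma>: "\<sigma> \<in> window_increasing n j k" and \<pi>: "\<pi> permutes {1..k}" and j: "1 \<le> j"
  shows "occurs_at k \<pi> j (\<sigma> \<circ> window_perm j k \<pi>)"
  unfolding occurs_at_def
proof (intro ballI)
  fix a b assume ab: "a \<in> {1..k}" "b \<in> {1..k}"
  have "\<pi> a \<in> {1..k}" "\<pi> b \<in> {1..k}" using ab permutes_in_image[OF \<pi>] by blast+
  moreover have "strict_mono_on {j..<j + k} \<sigma>" using \<sigma> by (auto simp: window_increasing_def)
  moreover have "j + \<pi> a - 1 \<in> {j..<j + k}" "j + \<pi> b - 1 \<in> {j..<j + k}"
    using calculation j by auto
  ultimately have "\<sigma> (j + \<pi> a - 1) < \<sigma> (j + \<pi> b - 1) \<longleftrightarrow> j + \<pi> a - 1 < j + \<pi> b - 1"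
    by (intro strict_mono_on_less)
  also have "\<dots> \<longleftrightarrow> \<pi> a < \<pi> b" using j by auto
  finally show "((\<sigma> \<circ> window_perm j k \<pi>) (j + a - 1) < (\<sigma> \<circ> window_perm j k \<pi>) (j + b - 1)) \<longleftrightarrow> \<pi> a < \<pi> b"
    unfolding o_apply window_perm_nth[OF j ab(1)] window_perm_nth[OF j ab(2)] .
qed

text \<open>The inverse map composes with the inverse of the window permutation, which sorts a
  window of pattern \<open>\<pi>\<close>.\<close>

lemma bij_betw_occurs_at:
  assumes \<pi>: "\<pi> permutes {1..k}" and j: "1 \<le> j" "j + k \<le> n + 1"
  shows "bij_betw (\<lambda>\<sigma>. \<sigma> \<circ> window_perm j k \<pi>) (window_increasing n j k)
           {\<sigma>. \<sigma> permutes {1..n} \<and> occurs_at k \<pi> j \<sigma>}"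
proof (rule bij_betw_imageI)
  let ?p = "window_perm j k \<pi>" and ?W = "{j..<j + k}"
  have p: "?p permutes ?W" by (rule window_perm_permutes[OF \<pi> j(1)])
  have pn: "?p permutes {1..n}" by (rule permutes_subset[OF p]) (use j in auto)
  show "inj_on (\<lambda>\<sigma>. \<sigma> \<circ> ?p) (window_increasing n j k)"
  proof (rule inj_onI)
    fix s t :: "nat \<Rightarrow> nat" assume "s \<circ> ?p = t \<circ> ?p"
    then have "s \<circ> (?p \<circ> inv ?p) = t \<circ> (?p \<circ> inv ?p)" by (simp add: o_assoc)
    then show "s = t" by (simp add: permutes_inv_o[OF p])
  qed
  show "(\<lambda>\<sigma>. \<sigma> \<circ> ?p) ` window_increasing n j k = {\<sigma>. \<sigma> permutes {1..n} \<and> occurs_at k \<pi> j \<sigma>}"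
  proof (intro equalityI subsetI)
    fix s assume "s \<in> (\<lambda>\<sigma>. \<sigma> \<circ> ?p) ` window_increasing n j k"
    then show "s \<in> {\<sigma>. \<sigma> permutes {1..n} \<and> occurs_at k \<pi> j \<sigma>}"
      using occurs_at_comp_window_perm[OF _ \<pi> j(1)] permutes_compose[OF pn]
      by (auto simp: window_increasing_def)
  next
    fix s assume "s \<in> {\<sigma>. \<sigma> permutes {1..n} \<and> occurs_at k \<pi> j \<sigma>}"
    then have s: "s permutes {1..n}" and occ: "occurs_at k \<pi> j s" by auto
    let ?t = "s \<circ> inv ?p"
    have "strict_mono_on ?W ?t"
    proof (rule strict_mono_onI)
      fix x y assume xy: "x \<in> ?W" "y \<in> ?W" "x < y"
      obtain a where a: "a \<in> {1..k}" "x = j + a - 1" using window_nthE[OF xy(1) j(1)] .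
      obtain b where b: "b \<in> {1..k}" "y = j + b - 1" using window_nthE[OF xy(2) j(1)] .
      obtain a' where a': "a' \<in> {1..k}" "a = \<pi> a'" using a(1) permutes_image[OF \<pi>] by blast
      obtain b' where b': "b' \<in> {1..k}" "b = \<pi> b'" using b(1) permutes_image[OF \<pi>] by blast
      have "inv ?p x = j + a' - 1" "inv ?p y = j + b' - 1"
        using window_perm_nth[OF j(1) a'(1), of \<pi>] window_perm_nth[OF j(1) b'(1), of \<pi>] a b a' b' p
        by (auto simp: permutes_inv_eq)
      moreover have "\<pi> a' < \<pi> b'" using xy(3) a b a' b' by auto
      ultimately show "?t x < ?t y" using occ a'(1) b'(1) by (simp add: occurs_at_def)
    qed
    moreover have "?t permutes {1..n}" by (rule permutes_compose[OF permutes_inv[OF pn] s])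
    ultimately have "?t \<in> window_increasing n j k" by (simp add: window_increasing_def)
    moreover have "s = ?t \<circ> ?p" by (simp add: o_assoc[symmetric] permutes_inv_o[OF p])
    ultimately show "s \<in> (\<lambda>\<sigma>. \<sigma> \<circ> ?p) ` window_increasing n j k" by blast
  qed
qed

text \<open>Every permutation has exactly one pattern in its window, so the bijections for the
  single patterns glue together.\<close>

lemma bij_betw_window_decomposition:
  assumes j: "1 \<le> j" "j + k \<le> n + 1"
  shows "bij_betw (\<lambda>(\<sigma>, \<pi>). \<sigma> \<circ> window_perm j k \<pi>)
           (window_increasing n j k \<times> {\<pi>. \<pi> permutes {1..k}}) {\<sigma>. \<sigma> permutes {1..n}}"
proof (rule bij_betw_imageI)
  let ?f = "\<lambda>(\<sigma>, \<pi>). \<sigma> \<circ> window_perm j k \<pi>" and ?S = "window_increasing n j k \<times> {\<pi>. \<pi> permutes {1..k}}"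
  show "inj_on ?f ?S"
  proof (rule inj_onI)
    fix x y assume xy: "x \<in> ?S" "y \<in> ?S" "?f x = ?f y"
    obtain s p t r where st: "x = (s, p)" "y = (t, r)" by (cases x, cases y)
    have pr: "p permutes {1..k}" "r permutes {1..k}" and st': "s \<in> window_increasing n j k" "t \<in> window_increasing n j k"
      using xy st by auto
    have "p = r"
      using pattern_unique[OF pr, of j "?f x"] xy(3) st
        occurs_at_comp_window_perm[OF st'(1) pr(1) j(1)] occurs_at_comp_window_perm[OF st'(2) pr(2) j(1)] by simp
    moreover have "s = t"
      using bij_betw_imp_inj_on[OF bij_betw_occurs_at[OF pr(1) j]] st' xy(3) st \<open>p = r\<close>
      by (auto dest: inj_onD)
    ultimately show "x = y" using st by simp
  qed
  show "?f ` ?S = {\<sigma>. \<sigma> permutes {1..n}}"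
  proof (intro equalityI subsetI)
    fix s assume "s \<in> ?f ` ?S"
    then show "s \<in> {\<sigma>. \<sigma> permutes {1..n}}"
      using bij_betw_imp_surj_on[OF bij_betw_occurs_at[OF _ j]] by auto
  next
    fix s assume "s \<in> {\<sigma>. \<sigma> permutes {1..n}}"
    then have s: "s permutes {1..n}" by simp
    obtain \<pi> where \<pi>: "\<pi> permutes {1..k}" "occurs_at k \<pi> j s"
      using pattern_exists[OF permutes_inj[OF s] j(1)] .
    then obtain t where "t \<in> window_increasing n j k" "s = t \<circ> window_perm j k \<pi>"
      using bij_betw_imp_surj_on[OF bij_betw_occurs_at[OF \<pi>(1) j]] s by blast
    then show "s \<in> ?f ` ?S" using \<pi> by (intro image_eqI[of _ _ "(t, \<pi>)"]) auto
  qed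
qed

section \<open>Inversion generating functions\<close>

text \<open>The generating function of the Mahonian numbers.\<close>

definition inv_poly :: "nat \<Rightarrow> real poly" where
  "inv_poly n = (\<Sum>\<sigma> | \<sigma> permutes {1..n}. monom 1 (inv_count n \<sigma>))"

definition window_poly :: "nat \<Rightarrow> nat \<Rightarrow> nat \<Rightarrow> real poly" where
  "window_poly n j k = (\<Sum>\<sigma>\<in>window_increasing n j k. monom 1 (inv_count n \<sigma>))"

text \<open>The q-integer, with the polynomial variable in the role of q.\<close>

definition qint :: "nat \<Rightarrow> real poly" where
  "qint i = (\<Sum>l<i. monom 1 l)"

lemma coeff_sum_monom:
  assumes "finite S"
  shows "coeff (\<Sum>s\<in>S. monom (1::real) (f s)) m = real (card {s \<in> S. f s = m})"
proof -
  have "coeff (\<Sum>s\<in>S. monom (1::real) (f s)) m = (\<Sum>s\<in>S. if f s = m then 1 else 0)"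
    by (simp add: coeff_sum)
  also have "\<dots> = (\<Sum>s\<in>{s \<in> S. f s = m}. 1)"
    by (rule sum.inter_filter[OF assms, symmetric])
  finally show ?thesis by simp
qed

text \<open>The window decomposition is a bijection under which inversion numbers add, so the
  generating function factors.\<close>

lemma inv_poly_window:
  assumes j: "1 \<le> j" "j + k \<le> n + 1"
  shows "inv_poly n = window_poly n j k * inv_poly k"
proof -
  have "inv_poly n = (\<Sum>(\<sigma>, \<pi>) \<in> window_increasing n j k \<times> {\<pi>. \<pi> permutes {1..k}}.
          monom 1 (inv_count n (\<sigma> \<circ> window_perm j k \<pi>)))"
    unfolding inv_poly_def
    by (subst sum.reindex_bij_betw[OF bij_betw_window_decomposition[OF j], symmetric])
       (simp add: case_prod_unfold)
  also have "\<dots> = (\<Sum>(\<sigma>, \<pi>) \<in> window_increasing n j k \<times> {\<pi>. \<pi> permutes {1..k}}.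
          monom 1 (inv_count n \<sigma>) * monom 1 (inv_count k \<pi>))"
    by (intro sum.cong refl) (auto simp: inv_count_comp_window_perm[OF _ _ j] mult_monom)
  also have "\<dots> = window_poly n j k * inv_poly k"
    by (simp add: window_poly_def inv_poly_def sum_product sum.cartesian_product)
  finally show ?thesis .
qed

text \<open>The window covers all positions but the last. The last value determines such a
  permutation, and every inversion involves the last position; the number of inversions therefore
  takes each of the values \<open>0, ..., n\<close> once.\<close>

lemma window_poly_last: "window_poly (Suc n) 1 n = qint (Suc n)"
proof -
  let ?W = "window_increasing (Suc n) 1 n"
  have perm: "\<sigma> permutes {1..Suc n}" and mono: "strict_mono_on {1..<1 + n} \<sigma>" if "\<sigma> \<in> ?W" for \<sigma>
    using that by (auto simp: window_increasing_def)
  \<comment> \<open>By the rank formula, an entry of the increasing block is its position, shifted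
    up by one if it lies above the last value.\<close>
  have vals: "\<sigma> i = i + (if \<sigma> (Suc n) < \<sigma> i then 1 else 0)" if "\<sigma> \<in> ?W" "i \<in> {1..n}" for \<sigma> i
  proof -
    have "{b \<in> {1..Suc n}. \<sigma> b \<le> \<sigma> i} = {1..i} \<union> (if \<sigma> (Suc n) < \<sigma> i then {Suc n} else {})"
    proof -
      have "\<sigma> b \<le> \<sigma> i \<longleftrightarrow> b \<le> i" if "b \<in> {1..n}" for b
        using strict_mono_on_less_eq[OF mono[OF \<open>\<sigma> \<in> ?W\<close>], of b i] that \<open>i \<in> {1..n}\<close> by auto
      moreover have "\<sigma> (Suc n) \<le> \<sigma> i \<longleftrightarrow> \<sigma> (Suc n) < \<sigma> i"
        using permutes_inj[OF perm[OF that(1)]] that(2) by (auto simp: le_less inj_eq)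
      ultimately show ?thesis using that(2) by (auto simp: atLeastAtMostSuc_conv le_Suc_eq split: if_splits)
    qed
    then have "\<sigma> i = card ({1..i} \<union> (if \<sigma> (Suc n) < \<sigma> i then {Suc n} else {}))"
      using permutes_eq_card_le[OF perm[OF that(1)], of i] that(2) by simp
    then show ?thesis using that(2) by (simp split: if_splits)
  qed
  have inv: "inv_count (Suc n) \<sigma> = Suc n - \<sigma> (Suc n)" if "\<sigma> \<in> ?W" for \<sigma>
  proof -
    have "\<sigma> (Suc n) = card {b \<in> {1..Suc n}. \<sigma> b \<le> \<sigma> (Suc n)}"
      by (rule permutes_eq_card_le[OF perm[OF that]]) auto
    also have "\<dots> = card ({1..Suc n} - {b \<in> {1..n}. \<sigma> b > \<sigma> (Suc n)})"
      by (intro arg_cong[of _ _ card]) (auto simp: le_Suc_eq)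
    also have "\<dots> = Suc n - card {b \<in> {1..n}. \<sigma> b > \<sigma> (Suc n)}"
      by (subst card_Diff_subset) auto
    finally have 1: "\<sigma> (Suc n) = Suc n - card {b \<in> {1..n}. \<sigma> b > \<sigma> (Suc n)}" .
    have 2: "card {b \<in> {1..n}. \<sigma> b > \<sigma> (Suc n)} \<le> n"
      by (rule order.trans[OF card_mono[of "{1..n}"]]) auto
    have "inversions (Suc n) \<sigma> = (\<lambda>b. (b, Suc n)) ` {b \<in> {1..n}. \<sigma> b > \<sigma> (Suc n)}"
    proof -
      have "\<not> \<sigma> b < \<sigma> a" if "a \<in> {1..n}" "b \<in> {1..n}" "a < b" for a b
        using strict_mono_on_less[OF mono[OF \<open>\<sigma> \<in> ?W\<close>], of b a] that by auto
      then show ?thesis by (auto simp: inversions_def le_Suc_eq image_iff)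
    qed
    then have "inv_count (Suc n) \<sigma> = card {b \<in> {1..n}. \<sigma> b > \<sigma> (Suc n)}"
      by (simp add: inv_count_def card_image inj_on_def)
    then show ?thesis using 1 2 by simp
  qed
  have last: "\<sigma> (Suc n) \<in> {1..Suc n}" if "\<sigma> \<in> ?W" for \<sigma>
    using permutes_in_image[OF perm[OF that], of "Suc n"] by simp
  have inj: "inj_on (inv_count (Suc n)) ?W"
  proof (rule inj_onI, rule ext)
    fix s t i assume st: "s \<in> ?W" "t \<in> ?W" "inv_count (Suc n) s = inv_count (Suc n) t"
    have eq: "s (Suc n) = t (Suc n)" using inv st last[OF st(1)] last[OF st(2)] by auto
    consider "i \<in> {1..n}" | "i = Suc n" | "i \<notin> {1..Suc n}" by fastforce
    then show "s i = t i"
    proof cases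
      case 1
      have "s (Suc n) \<noteq> s i" "t (Suc n) \<noteq> t i"
        using permutes_inj[OF perm[OF st(1)]] permutes_inj[OF perm[OF st(2)]] 1 by (auto simp: inj_eq)
      then show ?thesis using vals[OF st(1) 1] vals[OF st(2) 1] eq by (auto split: if_splits)
    next
      case 3
      then show ?thesis using perm[OF st(1)] perm[OF st(2)] by (metis permutes_not_in)
    qed (use eq in simp)
  qed
  \<comment> \<open>Counting replaces the construction of the permutations: injectivity suffices.\<close>
  have "card ?W * fact n = fact (Suc n)"
    using bij_betw_same_card[OF bij_betw_window_decomposition[of 1 n "Suc n"]]
    by (simp add: card_cartesian_product card_permutations[of _ n] card_permutations[of _ "Suc n"])
  then have "card ?W = Suc n" unfolding fact_Suc by (subst (asm) mult_cancel2) auto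
  moreover have "inv_count (Suc n) ` ?W \<subseteq> {..<Suc n}" using inv last by fastforce
  ultimately have "inv_count (Suc n) ` ?W = {..<Suc n}"
    using card_image[OF inj] by (intro card_subset_eq) auto
  then show ?thesis
    unfolding window_poly_def qint_def
    by (subst sum.reindex_bij_betw[of "inv_count (Suc n)" ?W "{..<Suc n}", symmetric]) (use inj in \<open>auto simp: bij_betw_def\<close>)
qed

section \<open>Product formulas for the generating functions\<close>

lemma inv_poly_eq_prod: "inv_poly n = (\<Prod>i\<in>{1..n}. qint i)"
proof (induction n)
  case 0
  have "{\<sigma>. \<sigma> permutes {1..0::nat}} = {id}" by auto
  then show ?case by (simp add: inv_poly_def inv_count_def inversions_def)
next
  case (Suc n)
  then show ?case using inv_poly_window[of 1 n "Suc n"] window_poly_last[of n] by (simp add: prod.nat_ivl_Suc')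
qed

lemma poly_qint: "poly (qint i) x = (\<Sum>l<i. x ^ l)"
  by (simp add: qint_def poly_sum poly_monom)

lemma qint_nonzero: "i \<ge> 1 \<Longrightarrow> qint i \<noteq> 0"
proof
  assume "i \<ge> 1" "qint i = 0"
  then have "(\<Sum>l<i. (1::real) ^ l) = 0" using poly_qint[of i 1] by simp
  then show False using \<open>i \<ge> 1\<close> by simp
qed

text \<open>The factor \<open>inv_poly k\<close> cancels from the product for
  \<open>inv_poly n\<close>. The result is free of \<open>j\<close>, which is why the position does
  not affect the probability.\<close>

lemma window_poly_eq_prod:
  assumes j: "1 \<le> j" "j + k \<le> n + 1"
  shows "window_poly n j k = (\<Prod>i\<in>{k<..n}. qint i)"
proof -
  have "{1..n} = {k<..n} \<union> {1..k}" using j by auto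
  then have "inv_poly n = (\<Prod>i\<in>{k<..n}. qint i) * inv_poly k"
    unfolding inv_poly_eq_prod by (simp only:) (rule prod.union_disjoint, auto)
  moreover have "inv_poly k \<noteq> 0" by (simp add: inv_poly_eq_prod qint_nonzero)
  ultimately show ?thesis using inv_poly_window[OF j] by simp
qed

text \<open>Favourable permutations correspond to window-increasing ones with
  \<open>m - inv_count k \<tau>\<close> inversions, and \<open>inv_poly_window\<close> counts all
  permutations with \<open>m\<close> inversions. The bound on \<open>inv_count k \<pi>\<close> keeps
  the subtractions exact.\<close>

lemma prob_occurs_at:
  assumes \<tau>: "\<tau> permutes {1..k}" and j: "1 \<le> j" "j + k \<le> n + 1"
    and A: "A = (\<Prod>i\<in>{k<..n}. qint i)"
    and m: "\<And>\<pi>. \<pi> permutes {1..k} \<Longrightarrow> inv_count k \<pi> \<le> m"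
    and pos: "coeff A (m - inv_count k \<tau>) > 0"
  shows "measure_pmf.prob (random_perm n m) {\<sigma>. occurs_at k \<tau> j \<sigma>} =
    coeff A (m - inv_count k \<tau>) / (\<Sum>\<pi> | \<pi> permutes {1..k}. coeff A (m - inv_count k \<pi>))"
proof -
  have A': "A = window_poly n j k" using window_poly_eq_prod[OF j] A by simp
  let ?P = "perms_with_inv n m"
  have fin: "finite ?P"
    by (rule finite_subset[OF _ finite_permutations[of "{1..n}"]]) (auto simp: perms_with_inv_def)
  have "card (?P \<inter> {\<sigma>. occurs_at k \<tau> j \<sigma>}) = card {\<sigma> \<in> window_increasing n j k. inv_count n \<sigma> = m - inv_count k \<tau>}"
  proof (rule sym, rule bij_betw_same_card, rule bij_betw_imageI)
    let ?f = "\<lambda>\<sigma>. \<sigma> \<circ> window_perm j k \<tau>"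
    note b = bij_betw_occurs_at[OF \<tau> j]
    show "inj_on ?f {\<sigma> \<in> window_increasing n j k. inv_count n \<sigma> = m - inv_count k \<tau>}"
      by (rule inj_on_subset[OF bij_betw_imp_inj_on[OF b]]) auto
    have iff: "inv_count n (?f \<sigma>) = m \<longleftrightarrow> inv_count n \<sigma> = m - inv_count k \<tau>" if "\<sigma> \<in> window_increasing n j k" for \<sigma>
      using inv_count_comp_window_perm[OF that \<tau> j] m[OF \<tau>] by auto
    have "?P \<inter> {\<sigma>. occurs_at k \<tau> j \<sigma>} = {\<sigma> \<in> ?f ` window_increasing n j k. inv_count n \<sigma> = m}"
      unfolding bij_betw_imp_surj_on[OF b] by (auto simp: perms_with_inv_def)
    then show "?f ` {\<sigma> \<in> window_increasing n j k. inv_count n \<sigma> = m - inv_count k \<tau>} = ?P \<inter> {\<sigma>. occurs_at k \<tau> j \<sigma>}"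
      using iff by auto
  qed
  also have "real \<dots> = coeff A (m - inv_count k \<tau>)"
    unfolding A' window_poly_def by (simp add: coeff_sum_monom finite_window_increasing)
  finally have num: "real (card (?P \<inter> {\<sigma>. occurs_at k \<tau> j \<sigma>})) = coeff A (m - inv_count k \<tau>)" .
  \<comment> \<open>A positive count exhibits a member of \<open>?P\<close>; on an empty set
    \<open>pmf_of_set\<close> would be unspecified.\<close>
  then have "card (?P \<inter> {\<sigma>. occurs_at k \<tau> j \<sigma>}) \<noteq> 0" using pos by auto
  then have ne: "?P \<noteq> {}" by auto
  have "real (card ?P) = coeff (inv_poly n) m"
    unfolding inv_poly_def by (simp add: coeff_sum_monom finite_permutations perms_with_inv_def)
  also have "\<dots> = (\<Sum>\<pi> | \<pi> permutes {1..k}. coeff (monom 1 (inv_count k \<pi>) * A) m)"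
    unfolding inv_poly_window[OF j] A'[symmetric] inv_poly_def[of k]
    by (simp add: sum_distrib_left coeff_sum mult.commute del: coeff_monom)
  also have "\<dots> = (\<Sum>\<pi> | \<pi> permutes {1..k}. coeff A (m - inv_count k \<pi>))"
    by (intro sum.cong refl) (use m in \<open>fastforce simp: coeff_monom_mult not_le[symmetric]\<close>)
  finally show ?thesis
    unfolding random_perm_def measure_pmf_of_set[OF ne fin] num by simp
qed

section \<open>Log-concavity\<close>

text \<open>
  Integer indices avoid boundary cases in shifts. The inequality is required for every shift \<open>h\<close>, not
  just \<open>h = 1\<close>, because \<open>log_concave_window_sum\<close> needs all shifts of its hypothesis.
\<close>

definition log_concave_on_support :: "(int \<Rightarrow> real) \<Rightarrow> int \<Rightarrow> bool" where
  "log_concave_on_support a N \<longleftrightarrow>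
     (\<forall>s. 0 \<le> s \<and> s \<le> N \<longrightarrow> a s > 0) \<and> (\<forall>s. s < 0 \<or> s > N \<longrightarrow> a s = 0) \<and>
     (\<forall>x y h. x \<le> y \<longrightarrow> 0 \<le> h \<longrightarrow> a x * a (y + h) \<le> a (x + h) * a y)"

text \<open>Shifts compose: multiply the inequality for shift \<open>h\<close> by the unit step at
  \<open>x + h\<close>, \<open>y + h\<close> and cancel the common factor. It is positive because
  the support has no gaps.\<close>

lemma log_concave_on_supportI:
  assumes pos: "\<And>s. 0 \<le> s \<Longrightarrow> s \<le> N \<Longrightarrow> a s > 0"
    and zero: "\<And>s. s < 0 \<or> s > N \<Longrightarrow> a s = 0"
    and step: "\<And>x y. x \<le> y \<Longrightarrow> a x * a (y + 1) \<le> a (x + 1) * a y"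
  shows "log_concave_on_support a N"
proof -
  have nonneg: "a s \<ge> 0" for s using pos[of s] zero[of s] by (cases "0 \<le> s \<and> s \<le> N") auto
  have *: "a x * a (y + int h) \<le> a (x + int h) * a y" if "x \<le> y" for x y h
  proof (induction h)
    case (Suc h)
    define X X' Y Y' where "X = a (x + int h)" and "X' = a (x + int h + 1)"
      and "Y = a (y + int h)" and "Y' = a (y + int h + 1)"
    note defs = X_def X'_def Y_def Y'_def
    have "a x * Y' \<le> X' * a y"
    proof (cases "a x = 0 \<or> Y' = 0")
      case True
      then show ?thesis using nonneg by (auto simp: defs)
    next
      case False
      then have "0 \<le> x" "y + int h + 1 \<le> N"
        using zero[of x] zero[of "y + int h + 1"] by (force simp: defs)+
      then have XY: "X > 0" "Y > 0" using that by (auto simp: defs intro!: pos)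
      have "(a x * Y) * (X * Y') \<le> (X * a y) * (X' * Y)"
        by (rule mult_mono) (use Suc step[of "x + int h" "y + int h"] that in \<open>auto simp: defs nonneg\<close>)
      then have "(X * Y) * (a x * Y') \<le> (X * Y) * (X' * a y)" by (simp add: mult_ac)
      then show ?thesis using XY by simp
    qed
    then show ?case by (simp add: defs add_ac)
  qed simp
  have "a x * a (y + h) \<le> a (x + h) * a y" if "x \<le> y" "0 \<le> h" for x y h
    using *[of x y "nat h"] that by simp
  then show ?thesis using pos zero by (auto simp: log_concave_on_support_def)
qed

text \<open>This is multiplication by a q-integer. Once the product of the shared parts of the sums
  is removed, the remaining products compare term by term, with shifts that vary from term to
  term.\<close>

lemma log_concave_window_sum:
  assumes a: "log_concave_on_support a N" and N: "0 \<le> N"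
  shows "log_concave_on_support (\<lambda>s. \<Sum>u<Suc r. a (s - int u)) (N + int r)"
proof (rule log_concave_on_supportI)
  have pos: "\<And>s. 0 \<le> s \<Longrightarrow> s \<le> N \<Longrightarrow> a s > 0" and zero: "\<And>s. s < 0 \<or> s > N \<Longrightarrow> a s = 0"
    and lc: "\<And>x y h. x \<le> y \<Longrightarrow> 0 \<le> h \<Longrightarrow> a x * a (y + h) \<le> a (x + h) * a y"
    using a by (auto simp: log_concave_on_support_def)
  have nonneg: "a s \<ge> 0" for s using pos[of s] zero[of s] by (cases "0 \<le> s \<and> s \<le> N") auto
  {
    fix s :: int assume "0 \<le> s" "s \<le> N + int r"
    \<comment> \<open>The shift by \<open>nat (s - N)\<close> moves \<open>s\<close> to the smaller
      of \<open>s\<close> and \<open>N\<close>, which is in the support.\<close>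
    then have "a (s - int (nat (s - N))) > 0" "nat (s - N) \<in> {..<Suc r}"
      using N by (auto intro!: pos)
    then show "(\<Sum>u<Suc r. a (s - int u)) > 0"
      by (intro sum_pos2[of _ "nat (s - N)"]) (auto intro: nonneg)
  next
    fix s :: int assume "s < 0 \<or> s > N + int r"
    then show "(\<Sum>u<Suc r. a (s - int u)) = 0"
      by (intro sum.neutral ballI zero) auto
  next
    fix x y :: int assume xy: "x \<le> y"
    \<comment> \<open>\<open>T\<close> is the part common to the sums at \<open>x\<close> and
      \<open>x + 1\<close>, and \<open>T'\<close> the part common to those at \<open>y\<close> and
      \<open>y + 1\<close>.\<close>
    define T T' where "T = (\<Sum>u<r. a (x - int u))" and "T' = (\<Sum>u<r. a (y - int u))"
    have top: "(\<Sum>u<Suc r. a (z + 1 - int u)) = a (z + 1) + (\<Sum>u<r. a (z - int u))" for z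
      by (subst sum.lessThan_Suc_shift) (simp add: algebra_simps)
    have "a (x - int r) * T' \<le> T * a (y - int r)"
      unfolding T_def T'_def sum_distrib_left sum_distrib_right
    proof (rule sum_mono)
      fix u assume "u \<in> {..<r}"
      then show "a (x - int r) * a (y - int u) \<le> a (x - int u) * a (y - int r)"
        using lc[of "x - int r" "y - int r" "int r - int u"] xy by simp
    qed
    moreover have "T * a (y + 1) \<le> a (x + 1) * T'"
      unfolding T_def T'_def sum_distrib_left sum_distrib_right
    proof (rule sum_mono)
      fix u assume "u \<in> {..<r}"
      then show "a (x - int u) * a (y + 1) \<le> a (x + 1) * a (y - int u)"
        using lc[of "x - int u" "y - int u" "int u + 1"] xy by simp
    qed
    moreover have "a (x - int r) * a (y + 1) \<le> a (x + 1) * a (y - int r)"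
      using lc[of "x - int r" "y - int r" "int r + 1"] xy by simp
    ultimately have "(T + a (x - int r)) * (a (y + 1) + T') \<le> (a (x + 1) + T) * (T' + a (y - int r))"
      by (simp add: algebra_simps)
    then show "(\<Sum>u<Suc r. a (x - int u)) * (\<Sum>u<Suc r. a (y + 1 - int u))
        \<le> (\<Sum>u<Suc r. a (x + 1 - int u)) * (\<Sum>u<Suc r. a (y - int u))"
      unfolding top by (simp add: T_def T'_def)
  }
qed

text \<open>Coefficients are extended by zero to negative indices, so shifting never meets truncated
  subtraction.\<close>

definition coeff_int :: "real poly \<Rightarrow> int \<Rightarrow> real" where
  "coeff_int p s = (if s < 0 then 0 else coeff p (nat s))"

lemma coeff_int_qint_mult: "coeff_int (qint l * p) s = (\<Sum>u<l. coeff_int p (s - int u))"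
  by (auto simp: coeff_int_def qint_def sum_distrib_right coeff_sum coeff_monom_mult nat_diff_distrib
           intro!: sum.cong arg_cong[of _ _ "coeff p"])

lemma log_concave_prod_qint:
  assumes "finite S" "\<And>i. i \<in> S \<Longrightarrow> i \<ge> 1"
  shows "log_concave_on_support (coeff_int (\<Prod>i\<in>S. qint i)) (int (\<Sum>i\<in>S. i - 1))"
  using assms
proof (induction S rule: finite_induct)
  case empty
  show ?case by (rule log_concave_on_supportI) (auto simp: coeff_int_def one_poly_eq_simps[symmetric] coeff_pCons split: nat.splits if_splits)
next
  case (insert i S)
  then obtain r where r: "i = Suc r" by (metis insertI1 not0_implies_Suc not_one_le_zero)
  have "log_concave_on_support (\<lambda>s. \<Sum>u<Suc r. coeff_int (\<Prod>i\<in>S. qint i) (s - int u)) (int (\<Sum>i\<in>S. i - 1) + int r)"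
    using insert.IH insert.prems by (intro log_concave_window_sum of_nat_0_le_iff) blast
  then show ?case using insert.hyps r by (simp add: coeff_int_qint_mult[abs_def] add.commute fun_eq_iff)
qed

lemma prod_qint_coeff:
  fixes k n :: nat
  defines "A \<equiv> \<Prod>i\<in>{k<..n}. qint i" and "N \<equiv> \<Sum>i\<in>{k<..n}. i - 1"
  shows "s \<le> N \<Longrightarrow> coeff A s > 0" "coeff A s \<ge> 0" "degree A \<le> N"
    "x \<le> y \<Longrightarrow> coeff A x * coeff A (Suc y) \<le> coeff A (Suc x) * coeff A y"
proof -
  have lc: "log_concave_on_support (coeff_int A) (int N)"
    unfolding A_def N_def by (rule log_concave_prod_qint) auto
  have c: "coeff A t = coeff_int A (int t)" for t by (simp add: coeff_int_def)
  show pos: "coeff A s > 0" if "s \<le> N" for s using lc that unfolding c by (auto simp: log_concave_on_support_def)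
  have zero: "coeff A s = 0" if "s > N" for s using lc that unfolding c by (auto simp: log_concave_on_support_def)
  show "coeff A s \<ge> 0" using pos[of s] zero[of s] by (cases "s \<le> N") auto
  show "degree A \<le> N" by (rule degree_le) (use zero in auto)
  show "coeff A x * coeff A (Suc y) \<le> coeff A (Suc x) * coeff A y" if "x \<le> y"
  proof -
    have "coeff_int A (int x) * coeff_int A (int y + 1) \<le> coeff_int A (int x + 1) * coeff_int A (int y)"
      using lc that unfolding log_concave_on_support_def by simp
    then show ?thesis unfolding c by (simp add: add.commute)
  qed
qed

lemma poly_eq_sum_atMost:
  fixes p :: "real poly"
  assumes "degree p \<le> N"
  shows "poly p x = (\<Sum>s\<le>N. coeff p s * x ^ s)"
  unfolding poly_altdef using assms by (intro sum.mono_neutral_left) (auto simp: coeff_eq_0)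

section \<open>Tilted coefficient sequences\<close>

context
  fixes p :: "real poly" and N :: nat
  assumes nonneg: "\<And>s. coeff p s \<ge> 0" and deg: "degree p \<le> N"
    and lc: "\<And>x y. x \<le> y \<Longrightarrow> coeff p x * coeff p (Suc y) \<le> coeff p (Suc x) * coeff p y"
begin

text \<open>Log-concavity makes the ratio of \<open>coeff p x\<close> to
  \<open>coeff p (Suc x)\<close> increase with \<open>x\<close>, so an upper bound at
  \<open>M\<close> passes to smaller indices; dually, a lower bound passes to larger ones.\<close>

lemma ratio_le_below:
  assumes "coeff p (Suc M) > 0" "coeff p M \<le> q * coeff p (Suc M)" "x \<le> M"
  shows "coeff p x \<le> q * coeff p (Suc x)"
proof -
  have "coeff p x * coeff p (Suc M) \<le> coeff p (Suc x) * coeff p M" using lc assms(3) .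
  also have "\<dots> \<le> coeff p (Suc x) * (q * coeff p (Suc M))" using assms(2) nonneg by (intro mult_left_mono)
  finally show ?thesis using assms(1) by (simp add: mult_ac)
qed

lemma ratio_ge_above:
  assumes "coeff p (Suc M) > 0" "q * coeff p (Suc M) \<le> coeff p M" "M \<le> y"
  shows "q * coeff p (Suc y) \<le> coeff p y"
proof -
  have "(q * coeff p (Suc M)) * coeff p (Suc y) \<le> coeff p M * coeff p (Suc y)"
    using assms(2) nonneg by (intro mult_right_mono)
  also have "\<dots> \<le> coeff p (Suc M) * coeff p y" using lc assms(3) .
  finally show ?thesis using assms(1) by (simp add: mult_ac)
qed

lemma coeff_pow_le_poly:
  assumes "0 \<le> y" "s \<le> N" shows "coeff p s * y ^ s \<le> poly p y"
  unfolding poly_eq_sum_atMost[OF deg] using assms nonneg by (intro member_le_sum) auto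

lemma tilted_sum_le:
  assumes "\<And>s. s \<le> N \<Longrightarrow> coeff p s * q ^ s * y ^ m \<le> poly p y * q ^ m"
  shows "poly p q * y ^ m \<le> (real N + 1) * (poly p y * q ^ m)"
proof -
  have "poly p q * y ^ m = (\<Sum>s\<le>N. coeff p s * q ^ s * y ^ m)"
    unfolding poly_eq_sum_atMost[OF deg] sum_distrib_right ..
  also have "\<dots> \<le> (\<Sum>s\<le>N. poly p y * q ^ m)" using assms by (intro sum_mono) auto
  finally show ?thesis by (simp add: add.commute)
qed

text \<open>
  In both bounds the tilted sequence \<open>coeff p s * q ^ s\<close> is monotone on the side of \<open>Suc M\<close> where the
  trivial estimate \<open>coeff p s * y ^ s \<le> poly p y\<close> loses, so it is dominated there by its value at \<open>Suc M\<close>.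
\<close>

lemma tilt_bound_ge:
  assumes M: "coeff p (Suc M) > 0" "q * coeff p (Suc M) \<le> coeff p M" and qy: "0 < y" "y \<le> q"
    and MN: "Suc M \<le> N"
  shows "poly p q * y ^ Suc M \<le> (real N + 1) * (poly p y * q ^ Suc M)"
proof (rule tilted_sum_le)
  fix s assume s: "s \<le> N"
  let ?m = "Suc M"
  show "coeff p s * q ^ s * y ^ ?m \<le> poly p y * q ^ ?m"
  proof (cases "s \<le> ?m")
    case True
    have "coeff p s * q ^ s * y ^ ?m = (coeff p s * y ^ s) * (q ^ s * y ^ (?m - s))"
      using True by (simp add: power_add[symmetric] mult_ac flip: power_Suc)
    also have "\<dots> \<le> poly p y * (q ^ s * q ^ (?m - s))"
      using qy s coeff_pow_le_poly[of y s] coeff_pow_le_poly[of y s] nonneg[of s]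
      by (intro mult_mono mult_left_mono power_mono) (auto intro: order.trans[OF _ coeff_pow_le_poly[of y s]])
    finally show ?thesis using True by (simp add: power_add[symmetric] flip: power_Suc)
  next
    case False
    have "coeff p t * q ^ t \<le> coeff p ?m * q ^ ?m" if "t \<ge> ?m" for t
      using that
    proof (induction t rule: dec_induct)
      case (step t)
      have "coeff p (Suc t) * q ^ Suc t = (q * coeff p (Suc t)) * q ^ t" by simp
      also have "\<dots> \<le> coeff p t * q ^ t"
        using ratio_ge_above[OF M, of t] step qy by (intro mult_right_mono) auto
      finally show ?case using step.IH by linarith
    qed simp
    then have "coeff p s * q ^ s * y ^ ?m \<le> (coeff p ?m * q ^ ?m) * y ^ ?m"
      using False qy by (intro mult_right_mono) auto
    also have "\<dots> = (coeff p ?m * y ^ ?m) * q ^ ?m" by (simp only: mult_ac)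
    also have "\<dots> \<le> poly p y * q ^ ?m"
      using qy MN by (intro mult_right_mono coeff_pow_le_poly) auto
    finally show ?thesis .
  qed
qed

lemma tilt_bound_le:
  assumes M: "coeff p (Suc M) > 0" "coeff p M \<le> q * coeff p (Suc M)" and qy: "0 < q" "q \<le> y"
    and MN: "Suc M \<le> N"
  shows "poly p q * y ^ Suc M \<le> (real N + 1) * (poly p y * q ^ Suc M)"
proof (rule tilted_sum_le)
  fix s assume s: "s \<le> N"
  let ?m = "Suc M"
  show "coeff p s * q ^ s * y ^ ?m \<le> poly p y * q ^ ?m"
  proof (cases "s \<ge> ?m")
    case True
    have "coeff p s * q ^ s * y ^ ?m = coeff p s * (q ^ (s - ?m) * y ^ ?m) * q ^ ?m"
      using True by (simp add: power_add[symmetric] mult_ac flip: power_Suc)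
    also have "\<dots> \<le> coeff p s * (y ^ (s - ?m) * y ^ ?m) * q ^ ?m"
      using qy nonneg[of s] by (intro mult_left_mono mult_right_mono power_mono) auto
    also have "\<dots> = (coeff p s * y ^ s) * q ^ ?m"
      using True by (simp add: power_add[symmetric] flip: power_Suc)
    also have "\<dots> \<le> poly p y * q ^ ?m"
      using qy s by (intro mult_right_mono coeff_pow_le_poly) auto
    finally show ?thesis .
  next
    case False
    then have "s \<le> ?m" by simp
    then have "coeff p s * q ^ s \<le> coeff p ?m * q ^ ?m"
    proof (induction s rule: inc_induct)
      case (step t)
      have "coeff p t * q ^ t \<le> (q * coeff p (Suc t)) * q ^ t"
        using ratio_le_below[OF M, of t] step qy by (intro mult_right_mono) auto
      also have "\<dots> = coeff p (Suc t) * q ^ Suc t" by simp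
      finally show ?case using step.IH by linarith
    qed simp
    then have "coeff p s * q ^ s * y ^ ?m \<le> (coeff p ?m * q ^ ?m) * y ^ ?m"
      using False qy by (intro mult_right_mono) auto
    also have "\<dots> = (coeff p ?m * y ^ ?m) * q ^ ?m" by (simp only: mult_ac)
    also have "\<dots> \<le> poly p y * q ^ ?m"
      using qy MN by (intro mult_right_mono coeff_pow_le_poly) auto
    finally show ?thesis .
  qed
qed

text \<open>The ratio bound at the top index holds for all lower ones and is applied
  \<open>s\<close> times.\<close>

lemma coeff_diff_le:
  assumes M: "coeff p (Suc M) > 0" "coeff p M \<le> q * coeff p (Suc M)" and q: "0 \<le> q" and s: "s \<le> Suc M"
  shows "coeff p (Suc M - s) \<le> q ^ s * coeff p (Suc M)"
  using s
proof (induction s)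
  case (Suc s)
  have "coeff p (Suc M - Suc s) \<le> q * coeff p (Suc M - s)"
    using ratio_le_below[OF M, of "Suc M - Suc s"] Suc.prems by (simp add: Suc_diff_le)
  also have "\<dots> \<le> q * (q ^ s * coeff p (Suc M))" using Suc q by (intro mult_left_mono) auto
  finally show ?case by simp
qed simp

text \<open>A lower ratio bound travels upwards only, so it is assumed at an index \<open>M\<close>
  below all those used on the way from \<open>m\<close> down to \<open>m - s\<close>.\<close>

lemma coeff_diff_ge:
  assumes M: "coeff p (Suc M) > 0" "q * coeff p (Suc M) \<le> coeff p M" and q: "0 \<le> q"
    and s: "M + s \<le> m"
  shows "q ^ s * coeff p m \<le> coeff p (m - s)"
  using s
proof (induction s)
  case (Suc s)
  have "q ^ Suc s * coeff p m \<le> q * coeff p (m - s)" using mult_left_mono[OF Suc.IH q] Suc.prems by (simp add: mult.assoc)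
  also have "\<dots> \<le> coeff p (m - Suc s)"
    using ratio_ge_above[OF M, of "m - Suc s"] Suc.prems by (simp add: Suc_diff_Suc)
  finally show ?case .
qed simp

end

section \<open>Asymptotics of coefficient ratios\<close>

lemma poly_prod_qint:
  assumes "0 < x" "x < 1" "k \<le> n"
  shows "poly (\<Prod>i\<in>{k<..n}. qint i) x = (\<Prod>i\<in>{k<..n}. 1 - x ^ i) / (1 - x) ^ (n - k)"
proof -
  have "poly (\<Prod>i\<in>{k<..n}. qint i) x = (\<Prod>i\<in>{k<..n}. (1 - x ^ i) / (1 - x))"
    unfolding poly_prod poly_qint using assms by (intro prod.cong refl) (simp add: sum_gp_strict)
  then show ?thesis by (simp add: prod_dividef)
qed

text \<open>From \<open>ln u \<le> u - 1\<close> at the reciprocal, \<open>- ln (1 - q ^ i)\<close>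
  is at most \<open>q ^ i / (1 - q ^ i)\<close>. Here \<open>1 - q ^ i\<close> is
  \<open>1 - q\<close> times a geometric sum whose \<open>i\<close> terms are at least
  \<open>q ^ i\<close>.\<close>

lemma ln_one_minus_power_ge:
  assumes q: "0 < q" "q < 1" and i: "i \<ge> 1"
  shows "ln (1 - q ^ i) \<ge> - (1 / (real i * (1 - q)))"
proof -
  have qi: "0 < q ^ i" "q ^ i < 1" using assms by (auto simp: power_less_one_iff)
  have "ln (1 / (1 - q ^ i)) \<le> 1 / (1 - q ^ i) - 1" using qi by (intro ln_le_minus_one) auto
  then have "- ln (1 - q ^ i) \<le> q ^ i / (1 - q ^ i)" using qi by (simp add: ln_div field_simps)
  also have "\<dots> \<le> 1 / (real i * (1 - q))"
  proof -
    have "(\<Sum>l<i. q ^ i) \<le> (\<Sum>l<i. q ^ l)" using q by (intro sum_mono power_decreasing) auto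
    then have "real i * q ^ i * (1 - q) \<le> (\<Sum>l<i. q ^ l) * (1 - q)" using q by (intro mult_right_mono) auto
    also have "\<dots> = 1 - q ^ i" using q by (simp add: sum_gp_strict)
    finally show ?thesis using q qi i by (simp add: field_simps)
  qed
  finally show ?thesis by simp
qed

lemma sum_inverse_le_ln:
  assumes "n \<ge> 1"
  shows "(\<Sum>i\<in>{1..n}. 1 / real i) \<le> 1 + ln (real n)"
  using assms
proof (induction n rule: dec_induct)
  case (step n)
  have "ln (real n / real (Suc n)) \<le> real n / real (Suc n) - 1"
    using step by (intro ln_le_minus_one) auto
  then have "1 / real (Suc n) \<le> ln (real (Suc n)) - ln (real n)"
    using step by (simp add: ln_div field_simps)
  then show ?case using step by simp
qed simp

lemma sum_ln_one_minus_power_ge: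
  assumes q: "0 < q" "q < 1" and n: "n \<ge> 1"
  shows "(\<Sum>i\<in>{k<..n}. ln (1 - q ^ i)) \<ge> - ((1 + ln (real n)) / (1 - q))"
proof -
  have "- (\<Sum>i\<in>{k<..n}. ln (1 - q ^ i)) \<le> (\<Sum>i\<in>{k<..n}. 1 / (real i * (1 - q)))"
    unfolding sum_negf[symmetric]
  proof (rule sum_mono)
    fix i assume "i \<in> {k<..n}"
    then show "- ln (1 - q ^ i) \<le> 1 / (real i * (1 - q))"
      using ln_one_minus_power_ge[OF q, of i] by simp
  qed
  also have "\<dots> \<le> (\<Sum>i\<in>{1..n}. 1 / (real i * (1 - q)))" using q by (intro sum_mono2) auto
  also have "\<dots> = (\<Sum>i\<in>{1..n}. 1 / real i) / (1 - q)"
    by (simp add: sum_divide_distrib)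
  also have "\<dots> \<le> (1 + ln (real n)) / (1 - q)"
    using q sum_inverse_le_ln[OF n] by (intro divide_right_mono) auto
  finally show ?thesis by linarith
qed

text \<open>Take logarithms in the inequality that a tilt bound yields. The powers of
  \<open>d\<close> cancel and leave \<open>w ^ (n - k)\<close>; the product at \<open>1 - d\<close>
  is at most 1, the one at \<open>1 - w * d\<close> is bounded by a harmonic sum, and the ratio of
  the two tilts by \<open>ln u \<le> u - 1\<close>.\<close>

lemma tilt_bound_imp:
  fixes k n M :: nat and d w :: real
  defines "A \<equiv> \<Prod>i\<in>{k<..n}. qint i"
  assumes n: "n \<ge> 1" "k \<le> n" "N \<le> n\<^sup>2" and d: "0 < d" "d < 1" "0 < w" "w * d < 1"
    and le: "poly A (1 - w * d) * (1 - d) ^ M \<le> (real N + 1) * (poly A (1 - d) * (1 - w * d) ^ M)"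
  shows "- real (n - k) * ln w - (1 + ln (real n)) / (w * d)
           \<le> ln ((real n)\<^sup>2 + 1) + real M * ((1 - w) * d / (1 - d))"
proof -
  let ?q = "1 - w * d" and ?y = "1 - d"
  define Pq Py where "Pq = (\<Prod>i\<in>{k<..n}. 1 - ?q ^ i)" and "Py = (\<Prod>i\<in>{k<..n}. 1 - ?y ^ i)"
  have q: "0 < ?q" "?q < 1" and y: "0 < ?y" "?y < 1" using d by auto
  have pos: "0 < 1 - x ^ i" if "0 < x" "x < 1" "i \<in> {k<..n}" for x :: real and i
    using that by (simp add: power_less_one_iff)
  have Pq: "Pq > 0" unfolding Pq_def by (intro prod_pos pos[OF q])
  have Py: "Py > 0" unfolding Py_def by (intro prod_pos pos[OF y])
  have Py1: "Py \<le> 1" unfolding Py_def using pos[OF y] y by (intro prod_le_1) (auto intro: less_imp_le)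
  have lnPq: "ln Pq \<ge> - ((1 + ln (real n)) / (w * d))"
  proof -
    have "ln Pq = (\<Sum>i\<in>{k<..n}. ln (1 - ?q ^ i))"
      unfolding Pq_def using pos[OF q] by (intro ln_prod) (auto simp: less_imp_neq)
    then show ?thesis using sum_ln_one_minus_power_ge[OF q n(1), of k] by simp
  qed
  have Aq: "poly A ?q = Pq / (w * d) ^ (n - k)" unfolding A_def Pq_def by (subst poly_prod_qint[OF q n(2)]) simp
  have Ay: "poly A ?y = Py / d ^ (n - k)" unfolding A_def Py_def by (subst poly_prod_qint[OF y n(2)]) simp
  have "Pq / (w * d) ^ (n - k) * ?y ^ M \<le> ((real n)\<^sup>2 + 1) * (1 / d ^ (n - k) * ?q ^ M)"
  proof -
    have "poly A ?y * ?q ^ M \<le> 1 / d ^ (n - k) * ?q ^ M"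
      unfolding Ay using Py1 d q by (intro mult_right_mono divide_right_mono) auto
    moreover have "real N + 1 \<le> (real n)\<^sup>2 + 1" using n(3) by (simp flip: of_nat_power)
    moreover have "0 \<le> poly A ?y * ?q ^ M" unfolding Ay using Py d q by auto
    ultimately have "(real N + 1) * (poly A ?y * ?q ^ M) \<le> ((real n)\<^sup>2 + 1) * (1 / d ^ (n - k) * ?q ^ M)"
      by - (rule mult_mono, assumption+, auto)
    then show ?thesis using le unfolding Aq by linarith
  qed
  then have "Pq * ?y ^ M \<le> ((real n)\<^sup>2 + 1) * (w ^ (n - k) * ?q ^ M)"
    using d by (simp add: field_simps power_mult_distrib)
  then have "ln (Pq * ?y ^ M) \<le> ln (((real n)\<^sup>2 + 1) * (w ^ (n - k) * ?q ^ M))"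
    using Pq y d q by (subst ln_le_cancel_iff) (auto intro!: mult_pos_pos add_nonneg_pos)
  moreover have "(real n)\<^sup>2 + 1 > 0" by (intro add_nonneg_pos) auto
  ultimately have "ln Pq + real M * ln ?y \<le> ln ((real n)\<^sup>2 + 1) + (real (n - k) * ln w + real M * ln ?q)"
    using Pq y d q by (simp add: ln_mult_pos ln_realpow)
  moreover have "real M * ln ?q - real M * ln ?y \<le> real M * ((1 - w) * d / (1 - d))"
  proof -
    have "ln ?q - ln ?y = ln (?q / ?y)" using q y by (simp add: ln_div)
    also have "\<dots> \<le> ?q / ?y - 1" using q y by (intro ln_le_minus_one) auto
    also have "\<dots> = (1 - w) * d / (1 - d)" using y by (simp add: field_simps)
    finally have "real M * (ln ?q - ln ?y) \<le> real M * ((1 - w) * d / (1 - d))" by (rule mult_left_mono) auto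
    then show ?thesis by (simp add: algebra_simps)
  qed
  ultimately show ?thesis using lnPq by simp
qed

lemma sum_pred_greaterThanAtMost:
  assumes "k \<le> n"
  shows "real (\<Sum>i\<in>{k<..n}. i - 1) = real n * (real n - 1) / 2 - real k * (real k - 1) / 2"
  using assms
proof (induction n rule: dec_induct)
  case (step n)
  have "{k<..Suc n} = insert (Suc n) {k<..n}" using step by auto
  then show ?case using step by (simp add: field_simps)
qed simp

text \<open>The index sequence \<open>M\<close> is left general because the upper bound on the ratio
  is used at \<open>m\<close> and the lower bound at \<open>m - (k choose 2)\<close>.\<close>

lemma coeff_ratio_asymptotics:
  fixes k M :: "nat \<Rightarrow> nat" and d :: "nat \<Rightarrow> real"
  defines "A \<equiv> \<lambda>n. \<Prod>i\<in>{k n<..n}. qint i"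
  assumes kn: "(\<lambda>n. real (k n) / real n) \<longlonglongrightarrow> 0"
    and d: "filterlim d (at_right 0) sequentially"
    and dM: "(\<lambda>n. d n * real (M n) / real n) \<longlonglongrightarrow> 1"
    and dn: "(\<lambda>n. (1 + ln (real n)) / (d n * real n)) \<longlonglongrightarrow> 0"
    and w: "0 < w" "w \<noteq> 1"
  shows "eventually (\<lambda>n. M n \<ge> 1 \<and> k n \<le> n \<and> M n \<le> (\<Sum>i\<in>{k n<..n}. i - 1) \<and> 0 < d n \<and> 0 < 1 - w * d n \<and>
     (w < 1 \<longrightarrow> coeff (A n) (M n - 1) \<le> (1 - w * d n) * coeff (A n) (M n)) \<and>
     (w > 1 \<longrightarrow> coeff (A n) (M n - 1) \<ge> (1 - w * d n) * coeff (A n) (M n))) sequentially"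
proof -
  define N where "N n = (\<Sum>i\<in>{k n<..n}. i - 1)" for n
  have d0: "d \<longlonglongrightarrow> 0" and dpos: "eventually (\<lambda>n. d n > 0) sequentially"
    using d by (auto simp: filterlim_at elim: eventually_mono)
  have npos: "eventually (\<lambda>n::nat. n \<ge> 3) sequentially" by (rule eventually_ge_at_top)
  have kle: "eventually (\<lambda>n. k n \<le> n) sequentially"
    using order_tendstoD(2)[OF kn zero_less_one] npos
    by eventually_elim (simp add: field_simps)
  have dlt: "eventually (\<lambda>n. d n < 1 \<and> w * d n < 1) sequentially"
  proof -
    have "(\<lambda>n. w * d n) \<longlonglongrightarrow> w * 0" by (intro tendsto_intros d0)
    then show ?thesis using order_tendstoD(2)[OF d0, of 1] order_tendstoD(2)[of "\<lambda>n. w * d n" 0 _ 1]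
      by (auto intro: eventually_conj)
  qed
  have Mpos: "eventually (\<lambda>n. M n \<ge> 1) sequentially"
    using order_tendstoD(1)[OF dM zero_less_one] by eventually_elim (auto simp: Suc_le_eq intro: gr0I)
  have dn': "(\<lambda>n. 1 / (d n * real n)) \<longlonglongrightarrow> 0"
  proof (rule tendsto_sandwich[OF _ _ tendsto_const dn])
    show "eventually (\<lambda>n. 0 \<le> 1 / (d n * real n)) sequentially"
      using dpos by eventually_elim simp
    show "eventually (\<lambda>n. 1 / (d n * real n) \<le> (1 + ln (real n)) / (d n * real n)) sequentially"
      using dpos npos by eventually_elim (intro divide_right_mono, auto)
  qed
  \<comment> \<open>\<open>M\<close> is of smaller order than \<open>n\<^sup>2\<close>, whereas the
    top index \<open>N n\<close> is about \<open>n\<^sup>2 / 2\<close>.\<close>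
  have MN: "eventually (\<lambda>n. M n \<le> N n) sequentially"
  proof -
    have "(\<lambda>n. (d n * real (M n) / real n) * (1 / (d n * real n))) \<longlonglongrightarrow> 1 * 0"
      by (intro tendsto_mult dM dn')
    moreover have "eventually (\<lambda>n. (d n * real (M n) / real n) * (1 / (d n * real n)) = real (M n) / (real n)\<^sup>2) sequentially"
      using dpos npos by eventually_elim (auto simp: field_simps power2_eq_square)
    ultimately have M2: "(\<lambda>n. real (M n) / (real n)\<^sup>2) \<longlonglongrightarrow> 0"
      by (simp add: Lim_transform_eventually)
    have "(\<lambda>n. (1 - 1 / real n) / 2 - (real (k n) / real n)\<^sup>2 / 2 - real (M n) / (real n)\<^sup>2) \<longlonglongrightarrow> (1 - 0) / 2 - 0\<^sup>2 / 2 - 0"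
      by (intro tendsto_intros kn M2 lim_1_over_n) auto
    then have "eventually (\<lambda>n. (1 - 1 / real n) / 2 - (real (k n) / real n)\<^sup>2 / 2 - real (M n) / (real n)\<^sup>2 > 0) sequentially"
      by (rule order_tendstoD) simp
    then show ?thesis using npos kle
    proof eventually_elim
      case (elim n)
      have "0 < (real n)\<^sup>2 * ((1 - 1 / real n) / 2 - (real (k n) / real n)\<^sup>2 / 2 - real (M n) / (real n)\<^sup>2)"
        using elim by (intro mult_pos_pos) auto
      also have "\<dots> = real n * (real n - 1) / 2 - (real (k n))\<^sup>2 / 2 - real (M n)"
        using elim by (simp add: field_simps power2_eq_square)
      also have "\<dots> \<le> real (N n) - real (M n)"
        unfolding N_def sum_pred_greaterThanAtMost[OF elim(3)] by (simp add: field_simps power2_eq_square)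
      finally show ?case by simp
    qed
  qed
  have "eventually (\<lambda>n. - real (n - k n) * ln w - (1 + ln (real n)) / (w * d n)
           > ln ((real n)\<^sup>2 + 1) + real (M n) * ((1 - w) * d n / (1 - d n))) sequentially"
  proof -
    have ln2: "(\<lambda>n::nat. ln ((real n)\<^sup>2 + 1) / real n) \<longlonglongrightarrow> 0" by real_asymp
    have "(\<lambda>n. - (1 - real (k n) / real n) * ln w - (1 + ln (real n)) / (d n * real n) / w
            - ln ((real n)\<^sup>2 + 1) / real n - (d n * real (M n) / real n) * (1 - w) / (1 - d n))
          \<longlonglongrightarrow> - (1 - 0) * ln w - 0 / w - 0 - 1 * (1 - w) / (1 - 0)"
      using w by (intro tendsto_intros kn dn ln2 dM d0) auto
    \<comment> \<open>The limit is \<open>w - 1 - ln w\<close>, strictly positive since equality in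
      \<open>ln w \<le> w - 1\<close> occurs only at 1.\<close>
    moreover have "0 < - (1 - 0) * ln w - 0 / w - 0 - 1 * (1 - w) / (1 - 0)"
      using w ln_le_minus_one[of w] ln_eq_minus_one[of w] by (cases "ln w = w - 1") auto
    ultimately have "eventually (\<lambda>n. 0 < - (1 - real (k n) / real n) * ln w - (1 + ln (real n)) / (d n * real n) / w
            - ln ((real n)\<^sup>2 + 1) / real n - (d n * real (M n) / real n) * (1 - w) / (1 - d n)) sequentially"
      by (rule order_tendstoD)
    then show ?thesis using npos kle dpos dlt
    proof eventually_elim
      case (elim n)
      have "0 < real n * (- (1 - real (k n) / real n) * ln w - (1 + ln (real n)) / (d n * real n) / w
            - ln ((real n)\<^sup>2 + 1) / real n - (d n * real (M n) / real n) * (1 - w) / (1 - d n))"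
        using elim by (intro mult_pos_pos) auto
      also have "\<dots> = - real (n - k n) * ln w - (1 + ln (real n)) / (w * d n)
           - (ln ((real n)\<^sup>2 + 1) + real (M n) * ((1 - w) * d n / (1 - d n)))"
        using elim w by (simp add: of_nat_diff field_simps)
      finally show ?case by simp
    qed
  qed
  then show ?thesis using npos kle dpos dlt Mpos MN
  proof eventually_elim
    case (elim n)
    obtain M' where M': "M n = Suc M'" using elim by (cases "M n") auto
    have "N n \<le> (\<Sum>i\<in>{k n<..n}. n)" unfolding N_def by (intro sum_mono) auto
    also have "\<dots> \<le> n\<^sup>2" by (simp add: power2_eq_square)
    finally have "N n \<le> n\<^sup>2" .
    have pos: "coeff (A n) (Suc M') > 0"
      using prod_qint_coeff(1)[of "Suc M'" "k n" n] elim M' by (simp add: A_def N_def)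
    note lc = prod_qint_coeff(2,3,4)[where k = "k n" and n = n]
    \<comment> \<open>The contrapositive of \<open>tilt_bound_imp\<close>. On either side of
      \<open>w = 1\<close>, a ratio on the wrong side would produce the negated inequality through
      the matching tilt bound.\<close>
    have bad: "\<not> poly (A n) (1 - w * d n) * (1 - d n) ^ Suc M' \<le> (real (N n) + 1) * (poly (A n) (1 - d n) * (1 - w * d n) ^ Suc M')"
      using tilt_bound_imp[of n "k n" "N n" "d n" w "Suc M'"] elim \<open>N n \<le> n\<^sup>2\<close> w M' unfolding A_def by auto
    have "coeff (A n) M' \<le> (1 - w * d n) * coeff (A n) (Suc M')" if "w < 1"
    proof (rule ccontr)
      assume "\<not> ?thesis"
      then have "(1 - w * d n) * coeff (A n) (Suc M') \<le> coeff (A n) M'" by simp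
      moreover have "1 - d n \<le> 1 - w * d n" using that elim by simp
      ultimately show False using bad tilt_bound_ge[of "A n" "N n" M' "1 - w * d n" "1 - d n"] lc pos elim M'
        unfolding A_def N_def by auto
    qed
    moreover have "(1 - w * d n) * coeff (A n) (Suc M') \<le> coeff (A n) M'" if "w > 1"
    proof (rule ccontr)
      assume "\<not> ?thesis"
      then have "coeff (A n) M' \<le> (1 - w * d n) * coeff (A n) (Suc M')" by simp
      moreover have "1 - w * d n \<le> 1 - d n" using that elim by simp
      ultimately show False using bad tilt_bound_le[of "A n" "N n" M' "1 - w * d n" "1 - d n"] lc pos elim M'
        unfolding A_def N_def by auto
    qed
    ultimately show ?case using elim M' by (auto simp: N_def)
  qed
qed

section \<open>The inversion generating function near 1\<close>

lemma poly_inv_poly: "poly (inv_poly k) q = (\<Sum>\<pi> | \<pi> permutes {1..k}. q ^ inv_count k \<pi>)"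
  by (simp add: inv_poly_def poly_sum poly_monom)

section \<open>Bounds for a single q-integer\<close>

lemma geometric_sum_ge_sqrt:
  assumes "0 < (q::real)"
  shows "(\<Sum>l<i. q ^ l) \<ge> real i * sqrt q ^ (i - 1)"
proof -
  let ?r = "sqrt q"
  have q: "q ^ l = ?r ^ l * ?r ^ l" for l using assms by (simp flip: power_mult_distrib)
  \<comment> \<open>Pair the exponents \<open>l\<close> and \<open>i - 1 - l\<close> and apply the
    inequality of arithmetic and geometric means.\<close>
  have "(\<Sum>l<i. 2 * ?r ^ (i - 1)) \<le> (\<Sum>l<i. q ^ l + q ^ (i - Suc l))"
  proof (rule sum_mono)
    fix l assume "l \<in> {..<i}"
    then have e: "?r ^ (i - 1) = ?r ^ l * ?r ^ (i - Suc l)" by (simp flip: power_add)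
    have "0 \<le> (?r ^ l - ?r ^ (i - Suc l))\<^sup>2" by simp
    then show "2 * ?r ^ (i - 1) \<le> q ^ l + q ^ (i - Suc l)"
      unfolding q e by (simp add: power2_eq_square algebra_simps)
  qed
  also have "\<dots> = 2 * (\<Sum>l<i. q ^ l)"
    by (simp add: sum.distrib sum.nat_diff_reindex[of "\<lambda>l. q ^ l" i])
  finally show ?thesis by simp
qed

text \<open>The quadratic Taylor polynomials of \<open>exp x\<close> and \<open>exp (- x)\<close>
  multiply to \<open>1 + x ^ 4 / 4\<close>, which is at least 1, and the first is a lower bound for
  \<open>exp x\<close>.\<close>

lemma exp_minus_le_quadratic:
  assumes "0 \<le> (x::real)"
  shows "exp (- x) \<le> 1 - x + x\<^sup>2 / 2"
proof -
  have *: "1 - x + x\<^sup>2 / 2 > 0"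
  proof -
    have "1 - x + x\<^sup>2 / 2 = ((1 - x)\<^sup>2 + 1) / 2" by (simp add: power2_eq_square field_simps)
    also have "\<dots> > 0" by (intro divide_pos_pos add_nonneg_pos) auto
    finally show ?thesis .
  qed
  have "(1 + x + x\<^sup>2 / 2) * (1 - x + x\<^sup>2 / 2) = 1 + x ^ 4 / 4"
    by (simp add: field_simps power2_eq_square power4_eq_xxxx)
  then have "1 \<le> (1 + x + x\<^sup>2 / 2) * (1 - x + x\<^sup>2 / 2)" by simp
  also have "\<dots> \<le> exp x * (1 - x + x\<^sup>2 / 2)"
    using exp_lower_Taylor_quadratic[OF assms] * by (intro mult_right_mono) auto
  finally show ?thesis by (simp add: exp_minus field_simps)
qed

text \<open>Bound each power by \<open>exp (- e * l)\<close> and then by its quadratic polynomial.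
  The linear terms sum exactly, and \<open>1 + u \<le> exp u\<close> gives a form that multiplies
  well over \<open>i\<close>.\<close>

lemma geometric_sum_le_exp:
  assumes e: "0 \<le> e" "e \<le> (1::real)"
  shows "(\<Sum>l<i. (1 - e) ^ l) \<le> real i * exp (- (e * real (i - 1) / 2) + e\<^sup>2 * (real i)\<^sup>2 / 2)"
proof -
  have "(\<Sum>l<i. (1 - e) ^ l) \<le> (\<Sum>l<i. 1 - e * real l + e\<^sup>2 * (real i)\<^sup>2 / 2)"
  proof (rule sum_mono)
    fix l assume l: "l \<in> {..<i}"
    have "(1 - e) ^ l \<le> exp (- e) ^ l" using e exp_ge_add_one_self[of "- e"] by (intro power_mono) auto
    also have "\<dots> = exp (- (e * real l))" by (simp flip: exp_of_nat_mult add: mult.commute)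
    also have "\<dots> \<le> 1 - e * real l + (e * real l)\<^sup>2 / 2" using e by (intro exp_minus_le_quadratic) auto
    also have "\<dots> \<le> 1 - e * real l + (e * real i)\<^sup>2 / 2" using l e
      by (intro add_left_mono divide_right_mono power_mono mult_left_mono) auto
    finally show "(1 - e) ^ l \<le> 1 - e * real l + e\<^sup>2 * (real i)\<^sup>2 / 2" by (simp add: power_mult_distrib)
  qed
  also have "\<dots> = real i * (1 + (- (e * real (i - 1) / 2) + e\<^sup>2 * (real i)\<^sup>2 / 2))"
  proof -
    have "(\<Sum>l<i. real l) = real i * real (i - 1) / 2"
    proof (induction i)
      case (Suc i)
      then show ?case by (cases i) (auto simp: field_simps)
    qed simp
    then show ?thesis by (simp add: sum.distrib sum_subtractf sum_distrib_left[symmetric] algebra_simps)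
  qed
  also have "\<dots> \<le> real i * exp (- (e * real (i - 1) / 2) + e\<^sup>2 * (real i)\<^sup>2 / 2)"
    by (intro mult_left_mono exp_ge_add_one_self) auto
  finally show ?thesis .
qed

lemma sum_pred_eq_choose_two: "(\<Sum>i\<in>{1..k}. i - 1) = k choose 2"
  by (induction k) (auto simp: numeral_2_eq_2)

text \<open>The exponent of \<open>q\<close> amounts to half of \<open>k choose 2\<close>, the mean
  inversion number of a uniform permutation of length \<open>k\<close>.\<close>

lemma poly_inv_poly_ge:
  assumes "0 < q"
  shows "poly (inv_poly k) q \<ge> fact k * sqrt q ^ (k choose 2)"
proof -
  have "fact k * sqrt q ^ (k choose 2) = (\<Prod>i\<in>{1..k}. real i * sqrt q ^ (i - 1))"
    by (simp add: prod.distrib fact_prod power_sum sum_pred_eq_choose_two[symmetric])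
  also have "\<dots> \<le> (\<Prod>i\<in>{1..k}. \<Sum>l<i. q ^ l)"
    using assms geometric_sum_ge_sqrt[OF assms] by (intro prod_mono) auto
  finally show ?thesis by (simp add: inv_poly_eq_prod poly_prod poly_qint)
qed

lemma poly_inv_poly_le:
  assumes "0 \<le> e" "e \<le> 1"
  shows "poly (inv_poly k) (1 - e) \<le> fact k * exp (- (e * real (k choose 2) / 2) + e\<^sup>2 * real k ^ 3 / 2)"
proof -
  have "poly (inv_poly k) (1 - e) = (\<Prod>i\<in>{1..k}. \<Sum>l<i. (1 - e) ^ l)"
    by (simp add: inv_poly_eq_prod poly_prod poly_qint)
  also have "\<dots> \<le> (\<Prod>i\<in>{1..k}. real i * exp (- (e * real (i - 1) / 2) + e\<^sup>2 * (real k)\<^sup>2 / 2))"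
  proof (intro prod_mono conjI sum_nonneg zero_le_power)
    fix i assume i: "i \<in> {1..k}"
    have "(\<Sum>l<i. (1 - e) ^ l) \<le> real i * exp (- (e * real (i - 1) / 2) + e\<^sup>2 * (real i)\<^sup>2 / 2)"
      by (rule geometric_sum_le_exp[OF assms])
    also have "\<dots> \<le> real i * exp (- (e * real (i - 1) / 2) + e\<^sup>2 * (real k)\<^sup>2 / 2)"
      using i assms by (intro mult_left_mono) (auto intro!: mult_left_mono power_mono)
    finally show "(\<Sum>l<i. (1 - e) ^ l) \<le> real i * exp (- (e * real (i - 1) / 2) + e\<^sup>2 * (real k)\<^sup>2 / 2)" .
  qed (use assms in auto)
  also have "\<dots> = fact k * exp (\<Sum>i\<in>{1..k}. - (e * real (i - 1) / 2) + e\<^sup>2 * (real k)\<^sup>2 / 2)"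
    by (simp add: prod.distrib fact_prod exp_sum)
  also have "(\<Sum>i\<in>{1..k}. - (e * real (i - 1) / 2) + e\<^sup>2 * (real k)\<^sup>2 / 2)
      = - (e * real (k choose 2) / 2) + e\<^sup>2 * real k ^ 3 / 2"
    unfolding sum_pred_eq_choose_two[symmetric] of_nat_sum sum.distrib sum_negf
    by (simp add: sum_distrib_left sum_divide_distrib power2_eq_square power3_eq_cube)
  finally show ?thesis .
qed

lemma inv_count_le_choose_two: "inv_count k \<pi> \<le> k choose 2"
proof -
  have "card (inversions k \<pi>) \<le> card {B. B \<subseteq> {1..k} \<and> card B = 2}"
  proof (rule card_inj_on_le)
    show "inj_on (\<lambda>(i, j). {i, j}) (inversions k \<pi>)"
      by (auto simp: inj_on_def inversions_def doubleton_eq_iff)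
    show "(\<lambda>(i, j). {i, j}) ` inversions k \<pi> \<subseteq> {B. B \<subseteq> {1..k} \<and> card B = 2}"
      by (auto simp: inversions_def)
  qed auto
  then show ?thesis by (simp add: inv_count_def n_subsets)
qed

text \<open>Write the power as the exponential of \<open>ln (1 - w * d n) / d n\<close> times
  \<open>d n * s n\<close>; the first factor tends to \<open>- w\<close>.\<close>

lemma tendsto_one_minus_power_exp:
  assumes d: "filterlim d (at_right 0) sequentially" and s: "(\<lambda>n. d n * real (s n)) \<longlonglongrightarrow> c"
  shows "(\<lambda>n. (1 - w * d n) ^ s n) \<longlonglongrightarrow> exp (- w * c)"
proof -
  have "((\<lambda>x. ln (1 - w * x) / x) \<longlongrightarrow> - w) (at_right 0)" by real_asymp
  from filterlim_compose[OF this d] have "(\<lambda>n. ln (1 - w * d n) / d n) \<longlonglongrightarrow> - w" .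
  then have "(\<lambda>n. exp (ln (1 - w * d n) / d n * (d n * real (s n)))) \<longlonglongrightarrow> exp (- w * c)"
    by (intro tendsto_intros s)
  moreover have "eventually (\<lambda>n. exp (ln (1 - w * d n) / d n * (d n * real (s n))) = (1 - w * d n) ^ s n) sequentially"
  proof -
    have d0: "d \<longlonglongrightarrow> 0" and dpos: "eventually (\<lambda>n. d n > 0) sequentially"
      using d by (auto simp: filterlim_at elim: eventually_mono)
    have "(\<lambda>n. w * d n) \<longlonglongrightarrow> w * 0" by (intro tendsto_intros d0)
    then have "eventually (\<lambda>n. w * d n < 1) sequentially" by (intro order_tendstoD) auto
    then show ?thesis using dpos
    proof eventually_elim
      case (elim n)
      have "exp (ln (1 - w * d n) / d n * (d n * real (s n))) = exp (real (s n) * ln (1 - w * d n))"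
        using elim by (simp add: field_simps)
      also have "\<dots> = (1 - w * d n) ^ s n" using elim by (simp add: exp_of_nat_mult)
      finally show ?case .
    qed
  qed
  ultimately show ?thesis by (rule Lim_transform_eventually)
qed

lemma real_choose_two: "real (k choose 2) = real k * (real k - 1) / 2"
  by (induction k) (auto simp: numeral_2_eq_2 field_simps)

section \<open>The probability of a pattern\<close>

text \<open>The ratio bound at \<open>m\<close> propagates down and the one at \<open>m - K\<close>
  up, so each coefficient involved lies between \<open>q2\<close> and \<open>q1\<close> to the power
  \<open>inv_count k \<pi>\<close>, times \<open>coeff A m\<close>. This last factor cancels, and
  the denominator is squeezed between values of \<open>inv_poly k\<close>.\<close>

lemma prob_occurs_at_bounds:
  fixes n k j m :: nat and q1 q2 :: real
  defines "A \<equiv> \<Prod>i\<in>{k<..n}. qint i" and "K \<equiv> k choose 2"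
  assumes \<tau>: "\<tau> permutes {1..k}" and j: "1 \<le> j" "j + k \<le> n + 1"
    and m: "m - K \<ge> 1" "m \<le> (\<Sum>i\<in>{k<..n}. i - 1)"
    and q: "0 < q1" "q1 \<le> 1" "0 < q2"
    and r1: "coeff A (m - 1) \<le> q1 * coeff A m"
    and r2: "coeff A (m - K - 1) \<ge> q2 * coeff A (m - K)"
  defines "X \<equiv> fact k * measure_pmf.prob (random_perm n m) {\<sigma>. occurs_at k \<tau> j \<sigma>}"
  shows "X \<le> q1 ^ inv_count k \<tau> / sqrt (q2 ^ K)"
    "X \<ge> q2 ^ inv_count k \<tau> / exp (- ((1 - q1) * real K / 2) + (1 - q1)\<^sup>2 * real k ^ 3 / 2)"
proof -
  note A = prod_qint_coeff[where k = k and n = n, folded A_def]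
  define c where "c = coeff A m"
  define S where "S = (\<Sum>\<pi> | \<pi> permutes {1..k}. coeff A (m - inv_count k \<pi>))"
  let ?F = "\<lambda>q. poly (inv_poly k) q"
  have c: "c > 0" unfolding c_def using m(2) by (rule A(1))
  have le: "inv_count k \<pi> \<le> K" for \<pi> unfolding K_def by (rule inv_count_le_choose_two)
  have up: "coeff A (m - inv_count k \<pi>) \<le> q1 ^ inv_count k \<pi> * c" for \<pi>
    using coeff_diff_le[where p = A and M = "m - 1" and q = q1 and s = "inv_count k \<pi>", OF A(2,3,4)] A(1)[OF m(2)] r1 q m(1) le[of \<pi>]
    by (simp add: c_def)
  have "Suc (m - K - 1) = m - K" using m(1) by simp
  then have lo: "q2 ^ inv_count k \<pi> * c \<le> coeff A (m - inv_count k \<pi>)" for \<pi>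
    using coeff_diff_ge[where p = A and M = "m - K - 1" and q = q2 and s = "inv_count k \<pi>" and m = m, OF A(2,3,4)] A(1)[of "m - K"] r2 q m le[of \<pi>]
    by (simp add: c_def)
  have S_up: "S \<le> c * ?F q1"
    unfolding S_def poly_inv_poly sum_distrib_left using up by (intro sum_mono) (simp add: mult.commute)
  have S_lo: "c * ?F q2 \<le> S"
    unfolding S_def poly_inv_poly sum_distrib_left using lo by (intro sum_mono) (simp add: mult.commute)
  have "coeff A (m - inv_count k \<tau>) > 0" using m(2) by (intro A(1)) auto
  then have X: "X = fact k * (coeff A (m - inv_count k \<tau>) / S)"
    unfolding X_def S_def
  proof (subst prob_occurs_at[OF \<tau> j, of A])
    show "inv_count k \<pi> \<le> m" for \<pi> using le[of \<pi>] m(1) by linarith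
  qed (auto simp: A_def)
  let ?a = "coeff A (m - inv_count k \<tau>)"
  let ?E = "exp (- ((1 - q1) * real K / 2) + (1 - q1)\<^sup>2 * real k ^ 3 / 2)"
  have Fq2: "fact k * sqrt q2 ^ K \<le> ?F q2" unfolding K_def by (rule poly_inv_poly_ge[OF q(3)])
  have Fq1: "?F q1 \<le> fact k * ?E" unfolding K_def using poly_inv_poly_le[of "1 - q1" k] q by simp
  have S0: "0 < c * (fact k * sqrt q2 ^ K)" using c q by simp
  have S_lo': "c * (fact k * sqrt q2 ^ K) \<le> S"
    using S_lo mult_left_mono[OF Fq2, of c] c by linarith
  have S_up': "S \<le> c * (fact k * ?E)"
    using S_up mult_left_mono[OF Fq1, of c] c by linarith
  have "?a / S \<le> (q1 ^ inv_count k \<tau> * c) / (c * (fact k * sqrt q2 ^ K))"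
    using up[of \<tau>] S_lo' S0 c q by (intro frac_le) auto
  then have "X \<le> fact k * ((q1 ^ inv_count k \<tau> * c) / (c * (fact k * sqrt q2 ^ K)))"
    unfolding X by (rule mult_left_mono) auto
  also have "\<dots> = q1 ^ inv_count k \<tau> / sqrt q2 ^ K" using c by simp
  finally show "X \<le> q1 ^ inv_count k \<tau> / sqrt (q2 ^ K)" by (simp add: real_sqrt_power)
  have "(q2 ^ inv_count k \<tau> * c) / (c * (fact k * ?E)) \<le> ?a / S"
    using lo[of \<tau>] less_le_trans[OF S0 S_lo'] S_up' A(2) by (intro frac_le) auto
  then have "fact k * ((q2 ^ inv_count k \<tau> * c) / (c * (fact k * ?E))) \<le> X"
    unfolding X by (rule mult_left_mono) auto
  then show "X \<ge> q2 ^ inv_count k \<tau> / ?E" using c by simp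
qed

theorem theorem2:
  fixes m k j :: "nat \<Rightarrow> nat"
    and \<tau> :: "nat \<Rightarrow> nat \<Rightarrow> nat"
    and \<alpha> \<rho> :: real
  assumes m_pos: "\<And>n. n \<ge> 1 \<Longrightarrow> m n \<ge> 1"
    and k_pos: "\<And>n. n \<ge> 1 \<Longrightarrow> k n \<ge> 1"
    and m_lower: "(\<lambda>n. real n) \<in> o[sequentially](\<lambda>n. real (m n))"
    and m_upper: "(\<lambda>n. real (m n)) \<in> o[sequentially](\<lambda>n. (real n)\<^sup>2 / (ln (real n))\<^sup>2)"
    and alpha_pos: "\<alpha> > 0"
    and k_asymp: "(\<lambda>n. real (k n)) \<sim>[sequentially] (\<lambda>n. \<alpha> * sqrt (real (m n) / real n))"
    and rho: "\<rho> \<in> {0..1}"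
    and tau_perm: "\<And>n. n \<ge> 1 \<Longrightarrow> \<tau> n permutes {1..k n}"
    and tau_dinv: "(\<lambda>n. dinv (k n) (\<tau> n)) \<longlonglongrightarrow> \<rho>"
    and j_pos: "\<And>n. n \<ge> 1 \<Longrightarrow> j n \<ge> 1"
    and j_le: "\<And>n. n \<ge> 1 \<Longrightarrow> j n \<le> n + 1 - k n"
  shows "(\<lambda>n. measure_pmf.prob (random_perm n (m n)) {\<sigma>. occurs_at (k n) (\<tau> n) (j n) \<sigma>})
           \<sim>[sequentially] (\<lambda>n. exp ((1 - 2 * \<rho>) * \<alpha>\<^sup>2 / 4) * (1 / fact (k n)))"
proof -

  \<comment> \<open>Limits of the parameter sequences\<close>
  define d where "d n = real n / real (m n)" for n
  define K where "K n = k n choose 2" for n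
  define s where "s n = inv_count (k n) (\<tau> n)" for n
  have n3: "eventually (\<lambda>n::nat. n \<ge> 3) sequentially" by (rule eventually_ge_at_top)
  have dpos: "d n > 0" if "n \<ge> 1" for n using m_pos[OF that] that by (simp add: d_def)
  have d0: "d \<longlonglongrightarrow> 0" using smalloD_tendsto[OF m_lower] by (simp add: d_def[abs_def])
  have d: "filterlim d (at_right 0) sequentially"
    unfolding filterlim_at using d0 by (auto intro!: eventually_mono[OF n3] dpos[THEN less_imp_neq, symmetric] dpos)
  have dn: "(\<lambda>n. (1 + ln (real n)) / (d n * real n)) \<longlonglongrightarrow> 0"
  proof (rule tendsto_sandwich[OF _ _ tendsto_const smalloD_tendsto[OF m_upper]])
    show "eventually (\<lambda>n. 0 \<le> (1 + ln (real n)) / (d n * real n)) sequentially"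
      using n3 by eventually_elim (use dpos in \<open>auto intro!: divide_nonneg_nonneg simp: d_def\<close>)
    \<comment> \<open>One logarithm would do for the ratio estimate; it is dominated by the squared
      logarithm in the hypothesis on \<open>m\<close>.\<close>
    have "eventually (\<lambda>n::nat. 1 + ln (real n) \<le> (ln (real n))\<^sup>2) sequentially" by real_asymp
    then show "eventually (\<lambda>n. (1 + ln (real n)) / (d n * real n) \<le> real (m n) / ((real n)\<^sup>2 / (ln (real n))\<^sup>2)) sequentially"
      using n3
    proof eventually_elim
      case (elim n)
      have "(1 + ln (real n)) / (d n * real n) = (1 + ln (real n)) * (real (m n) / (real n)\<^sup>2)"
        using elim m_pos[of n] by (simp add: d_def power2_eq_square field_simps)
      also have "\<dots> \<le> (ln (real n))\<^sup>2 * (real (m n) / (real n)\<^sup>2)" using elim by (intro mult_right_mono) auto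
      finally show ?case by (simp add: field_simps)
    qed
  qed
  have g: "(\<lambda>n. real (k n) * sqrt (d n)) \<longlonglongrightarrow> \<alpha>"
  proof -
    have "(\<lambda>n. real (k n) / (\<alpha> * sqrt (real (m n) / real n))) \<longlonglongrightarrow> 1"
    proof (rule asymp_equivD_strong[OF k_asymp])
      show "eventually (\<lambda>n. real (k n) \<noteq> 0 \<or> \<alpha> * sqrt (real (m n) / real n) \<noteq> 0) sequentially"
        using n3
      proof eventually_elim
        case (elim n)
        then show ?case using k_pos[of n] by simp
      qed
    qed
    then have "(\<lambda>n. \<alpha> * (real (k n) / (\<alpha> * sqrt (real (m n) / real n)))) \<longlonglongrightarrow> \<alpha> * 1" by (intro tendsto_intros)
    moreover have "\<alpha> * (real (k n) / (\<alpha> * sqrt (real (m n) / real n))) = real (k n) * sqrt (d n)" for n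
      using alpha_pos by (simp add: d_def real_sqrt_divide)
    ultimately show ?thesis by simp
  qed
  have sd: "(\<lambda>n. sqrt (d n)) \<longlonglongrightarrow> 0" using tendsto_real_sqrt[OF d0] by simp
  have ev_sq: "eventually (\<lambda>n. sqrt (d n) * sqrt (d n) = d n) sequentially"
    using n3 by eventually_elim (use dpos in \<open>auto simp: less_imp_le\<close>)
  have kd: "(\<lambda>n. real (k n) * d n) \<longlonglongrightarrow> 0"
  proof -
    have "(\<lambda>n. real (k n) * sqrt (d n) * sqrt (d n)) \<longlonglongrightarrow> \<alpha> * 0" by (intro tendsto_mult g sd)
    then have "(\<lambda>n. real (k n) * sqrt (d n) * sqrt (d n)) \<longlonglongrightarrow> 0" by simp
    then show ?thesis
      by (rule Lim_transform_eventually) (use ev_sq in eventually_elim, simp add: mult.assoc)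
  qed
  have k2d: "(\<lambda>n. (real (k n))\<^sup>2 * d n) \<longlonglongrightarrow> \<alpha>\<^sup>2"
  proof -
    have "(\<lambda>n. (real (k n) * sqrt (d n))\<^sup>2) \<longlonglongrightarrow> \<alpha>\<^sup>2" by (intro tendsto_intros g)
    then show ?thesis
      by (rule Lim_transform_eventually)
         (use ev_sq in eventually_elim, simp add: power_mult_distrib power2_eq_square)
  qed
  \<comment> \<open>A convergent sequence times a null one. This removes the error term of
    \<open>poly_inv_poly_le\<close>.\<close>
  have k3: "(\<lambda>n. (d n)\<^sup>2 * real (k n) ^ 3) \<longlonglongrightarrow> 0"
    using tendsto_mult[OF k2d kd] by (simp add: power2_eq_square power3_eq_cube mult_ac)
  have Kd: "(\<lambda>n. d n * real (K n)) \<longlonglongrightarrow> \<alpha>\<^sup>2 / 2"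
  proof -
    have "(\<lambda>n. ((real (k n))\<^sup>2 * d n - real (k n) * d n) / 2) \<longlonglongrightarrow> (\<alpha>\<^sup>2 - 0) / 2" by (intro tendsto_intros k2d kd) auto
    then show ?thesis by (simp add: K_def real_choose_two field_simps power2_eq_square)
  qed
  \<comment> \<open>If \<open>K n = 0\<close>, then \<open>s n = 0\<close> and \<open>dinv\<close>
    is a division by zero with value 0, so the identity persists.\<close>
  have s_eq: "real (s n) = dinv (k n) (\<tau> n) * real (K n)" for n
    using inv_count_le_choose_two[of "k n" "\<tau> n"] by (cases "K n = 0") (auto simp: s_def dinv_def K_def binomial_eq_0)
  have sd_lim: "(\<lambda>n. d n * real (s n)) \<longlonglongrightarrow> \<rho> * (\<alpha>\<^sup>2 / 2)"
    using tendsto_mult[OF tau_dinv Kd] by (simp add: s_eq mult_ac)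
  have inv_n: "(\<lambda>n. 1 / real n) \<longlonglongrightarrow> 0" by (rule lim_1_over_n)
  have kn: "(\<lambda>n. real (k n) / real n) \<longlonglongrightarrow> 0"
  proof -
    \<comment> \<open>The ratio \<open>k / n\<close> is bounded by a product of two null sequences,
      the factors \<open>d n\<close> cancelling.\<close>
    have "(\<lambda>n. real (k n) * d n * ((1 + ln (real n)) / (d n * real n))) \<longlonglongrightarrow> 0 * 0" by (intro tendsto_mult kd dn)
    then have lim: "(\<lambda>n. real (k n) * d n * ((1 + ln (real n)) / (d n * real n))) \<longlonglongrightarrow> 0" by simp
    show ?thesis
    proof (rule tendsto_sandwich[OF _ _ tendsto_const lim])
      show "eventually (\<lambda>n. real (k n) / real n \<le> real (k n) * d n * ((1 + ln (real n)) / (d n * real n))) sequentially"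
        using n3
      proof eventually_elim
        case (elim n)
        have "real (k n) * d n * ((1 + ln (real n)) / (d n * real n)) = real (k n) * (1 + ln (real n)) / real n"
          using elim dpos[of n] by (simp add: field_simps)
        moreover have "real (k n) * 1 \<le> real (k n) * (1 + ln (real n))" using elim by (intro mult_left_mono) auto
        ultimately show ?case using elim by (simp add: divide_right_mono)
      qed
    qed simp
  qed
  have Km: "(\<lambda>n. real (K n) / real (m n)) \<longlonglongrightarrow> 0"
  proof -
    have "(\<lambda>n. d n * real (K n) * (1 / real n)) \<longlonglongrightarrow> \<alpha>\<^sup>2 / 2 * 0" by (intro tendsto_mult Kd inv_n)
    then have "(\<lambda>n. d n * real (K n) * (1 / real n)) \<longlonglongrightarrow> 0" by simp
    then show ?thesis
      by (rule Lim_transform_eventually) (use n3 in eventually_elim, simp add: d_def)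
  qed
  have dm: "(\<lambda>n. d n * real (m n) / real n) \<longlonglongrightarrow> 1"
  proof (rule tendsto_eventually)
    show "eventually (\<lambda>n. d n * real (m n) / real n = 1) sequentially"
      using n3
    proof eventually_elim
      case (elim n)
      then show ?case using m_pos[of n] by (simp add: d_def)
    qed
  qed
  have dmK: "(\<lambda>n. d n * real (m n - K n) / real n) \<longlonglongrightarrow> 1"
  proof -
    have "(\<lambda>n. 1 - real (K n) / real (m n)) \<longlonglongrightarrow> 1 - 0" by (intro tendsto_intros Km)
    then have "(\<lambda>n. 1 - real (K n) / real (m n)) \<longlonglongrightarrow> 1" by simp
    \<comment> \<open>As \<open>K / m\<close> tends to 0, eventually \<open>m - K\<close> is a
      genuine subtraction, and \<open>d * m / n = 1\<close>.\<close>
    moreover have "eventually (\<lambda>n. 1 - real (K n) / real (m n) = d n * real (m n - K n) / real n) sequentially"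
      using n3 order_tendstoD(2)[OF Km zero_less_one]
    proof eventually_elim
      case (elim n)
      have "m n \<ge> 1" using m_pos elim by simp
      then have "K n \<le> m n" using elim by (simp add: field_simps)
      then show ?case using elim \<open>m n \<ge> 1\<close> by (simp add: d_def of_nat_diff field_simps)
    qed
    ultimately show ?thesis by (rule Lim_transform_eventually)
  qed

  \<comment> \<open>Squeezing the probability between the two bounds\<close>
  define P where "P n = measure_pmf.prob (random_perm n (m n)) {\<sigma>. occurs_at (k n) (\<tau> n) (j n) \<sigma>}" for n
  define L where "L = exp ((1 - 2 * \<rho>) * \<alpha>\<^sup>2 / 4)"
  define up where "up e n = (1 - (1 - e) * d n) ^ s n / sqrt ((1 - (1 + e) * d n) ^ K n)" for e n
  define lo where "lo e n = (1 - (1 + e) * d n) ^ s n /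
    exp (- ((1 - e) * d n * real (K n) / 2) + ((1 - e) * d n)\<^sup>2 * real (k n) ^ 3 / 2)" for e n
  have bounds: "eventually (\<lambda>n. lo e n \<le> fact (k n) * P n \<and> fact (k n) * P n \<le> up e n) sequentially"
    if e: "0 < e" "e < 1" for e
  proof -
    have w: "0 < 1 - e" "1 - e \<noteq> 1" "0 < 1 + e" "1 + e \<noteq> 1" using e by auto
    show ?thesis
      \<comment> \<open>The slope \<open>1 - e\<close> at \<open>m\<close> gives the upper ratio
        bound, and \<open>1 + e\<close> at \<open>m - K\<close> the lower one.\<close>
      using coeff_ratio_asymptotics[OF kn d dm dn w(1,2)] coeff_ratio_asymptotics[OF kn d dmK dn w(3,4)] n3
    proof eventually_elim
      case (elim n)
      have n: "n \<ge> 1" using elim by simp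
      have jk: "1 \<le> j n" "j n + k n \<le> n + 1" using j_pos[OF n] j_le[OF n] by auto
      have q1: "1 - (1 - e) * d n \<le> 1" using e dpos[OF n] by simp
      note b = prob_occurs_at_bounds[OF tau_perm[OF n] jk, of "m n" "1 - (1 - e) * d n" "1 - (1 + e) * d n"]
      show ?case unfolding lo_def up_def P_def s_def
        using b q1 elim e by (auto simp: K_def)
    qed
  qed
  have up_lim: "up e \<longlonglongrightarrow> exp (- (1 - e) * (\<rho> * (\<alpha>\<^sup>2 / 2))) / sqrt (exp (- (1 + e) * (\<alpha>\<^sup>2 / 2)))" for e
    unfolding up_def[abs_def]
    by (intro tendsto_divide tendsto_real_sqrt tendsto_one_minus_power_exp d sd_lim Kd) auto
  have lo_lim: "lo e \<longlonglongrightarrow> exp (- (1 + e) * (\<rho> * (\<alpha>\<^sup>2 / 2))) / exp (- ((1 - e) * (\<alpha>\<^sup>2 / 2) / 2) + (1 - e)\<^sup>2 * 0 / 2)" for e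
    unfolding lo_def[abs_def] power_mult_distrib mult.assoc
    by (intro tendsto_divide tendsto_exp tendsto_add tendsto_minus tendsto_mult tendsto_const
        tendsto_one_minus_power_exp[OF d sd_lim, unfolded mult.assoc] Kd k3) auto
  \<comment> \<open>For fixed \<open>e\<close> the bounds converge in \<open>n\<close>, and their
    limits tend to \<open>L\<close> as \<open>e\<close> decreases to 0. So for each \<open>a\<close>
    on one side of \<open>L\<close> a suitable \<open>e\<close> is fixed before \<open>n\<close>
    grows.\<close>
  have "(\<lambda>n. fact (k n) * P n) \<longlonglongrightarrow> L"
  proof (rule order_tendstoI)
    fix a assume "a < L"
    have "((\<lambda>e. exp (- (1 + e) * (\<rho> * (\<alpha>\<^sup>2 / 2))) / exp (- ((1 - e) * (\<alpha>\<^sup>2 / 2) / 2) + (1 - e)\<^sup>2 * 0 / 2))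
        \<longlongrightarrow> exp (- (1 + 0) * (\<rho> * (\<alpha>\<^sup>2 / 2))) / exp (- ((1 - 0) * (\<alpha>\<^sup>2 / 2) / 2) + (1 - 0)\<^sup>2 * 0 / 2)) (at_right 0)"
      by (intro tendsto_intros) auto
    \<comment> \<open>The exponents \<open>- \<rho> * \<alpha>\<^sup>2 / 2\<close> from the
      numerator and \<open>\<alpha>\<^sup>2 / 4\<close> from the denominator add up to that of
      \<open>L\<close>.\<close>
    moreover have "exp (- (1 + 0) * (\<rho> * (\<alpha>\<^sup>2 / 2))) / exp (- ((1 - 0) * (\<alpha>\<^sup>2 / 2) / 2) + (1 - 0)\<^sup>2 * 0 / 2) = L"
      by (simp add: L_def field_simps flip: exp_diff)
    ultimately have "eventually (\<lambda>e. a < exp (- (1 + e) * (\<rho> * (\<alpha>\<^sup>2 / 2))) / exp (- ((1 - e) * (\<alpha>\<^sup>2 / 2) / 2) + (1 - e)\<^sup>2 * 0 / 2)) (at_right 0)"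
      using \<open>a < L\<close> by (intro order_tendstoD(1)) auto
    moreover have "eventually (\<lambda>e::real. e \<in> {0<..<1}) (at_right 0)"
      by (rule eventually_at_right_real) simp
    ultimately have "\<exists>e. a < exp (- (1 + e) * (\<rho> * (\<alpha>\<^sup>2 / 2))) / exp (- ((1 - e) * (\<alpha>\<^sup>2 / 2) / 2) + (1 - e)\<^sup>2 * 0 / 2) \<and> e \<in> {0<..<1}"
      by (intro eventually_happens'[OF trivial_limit_at_right_real] eventually_conj)
    then obtain e where e: "a < exp (- (1 + e) * (\<rho> * (\<alpha>\<^sup>2 / 2))) / exp (- ((1 - e) * (\<alpha>\<^sup>2 / 2) / 2) + (1 - e)\<^sup>2 * 0 / 2)" "0 < e" "e < 1"
      by auto
    show "eventually (\<lambda>n. a < fact (k n) * P n) sequentially"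
      using bounds[OF e(2,3)] order_tendstoD(1)[OF lo_lim e(1)] by eventually_elim simp
  next
    fix a assume "L < a"
    have "((\<lambda>e. exp (- (1 - e) * (\<rho> * (\<alpha>\<^sup>2 / 2))) / sqrt (exp (- (1 + e) * (\<alpha>\<^sup>2 / 2))))
        \<longlongrightarrow> exp (- (1 - 0) * (\<rho> * (\<alpha>\<^sup>2 / 2))) / sqrt (exp (- (1 + 0) * (\<alpha>\<^sup>2 / 2)))) (at_right 0)"
      by (intro tendsto_intros) auto
    moreover have "exp (- (1 - 0) * (\<rho> * (\<alpha>\<^sup>2 / 2))) / sqrt (exp (- (1 + 0) * (\<alpha>\<^sup>2 / 2))) = L"
    proof -
      have "exp (- (1 + 0) * (\<alpha>\<^sup>2 / 2)) = (exp (- (\<alpha>\<^sup>2 / 4)))\<^sup>2" by (simp flip: exp_double)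
      then have "sqrt (exp (- (1 + 0) * (\<alpha>\<^sup>2 / 2))) = exp (- (\<alpha>\<^sup>2 / 4))" by simp
      then show ?thesis by (simp add: L_def field_simps flip: exp_diff)
    qed
    ultimately have "eventually (\<lambda>e. exp (- (1 - e) * (\<rho> * (\<alpha>\<^sup>2 / 2))) / sqrt (exp (- (1 + e) * (\<alpha>\<^sup>2 / 2))) < a) (at_right 0)"
      using \<open>L < a\<close> by (intro order_tendstoD(2)) auto
    moreover have "eventually (\<lambda>e::real. e \<in> {0<..<1}) (at_right 0)"
      by (rule eventually_at_right_real) simp
    ultimately have "\<exists>e. exp (- (1 - e) * (\<rho> * (\<alpha>\<^sup>2 / 2))) / sqrt (exp (- (1 + e) * (\<alpha>\<^sup>2 / 2))) < a \<and> e \<in> {0<..<1}"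
      by (intro eventually_happens'[OF trivial_limit_at_right_real] eventually_conj)
    then obtain e where e: "exp (- (1 - e) * (\<rho> * (\<alpha>\<^sup>2 / 2))) / sqrt (exp (- (1 + e) * (\<alpha>\<^sup>2 / 2))) < a" "0 < e" "e < 1"
      by auto
    show "eventually (\<lambda>n. fact (k n) * P n < a) sequentially"
      using bounds[OF e(2,3)] order_tendstoD(2)[OF up_lim e(1)] by eventually_elim simp
  qed
  then have "(\<lambda>n. fact (k n) * P n / L) \<longlonglongrightarrow> L / L" by (intro tendsto_intros) (auto simp: L_def)
  then have "(\<lambda>n. P n / (L * (1 / fact (k n)))) \<longlonglongrightarrow> 1" by (simp add: L_def field_simps)
  then show ?thesis unfolding P_def L_def by (rule asymp_equivI')
qed

end
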